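(* Let $n\ge2$, $0<\alpha<n$ and $p=n/\alpha$. Suppose that $\Omega$ satisfies the $L^s$-Dini smoothness condition $\mathfrak{D}_{s}$ with $s\geq n/(n-\alpha)$. Then there is a constant $C>0$ independent of $f$ such that $$\|T_{\Omega,\alpha}(f)\|_{\mathrm{BMO}}\le C\|f\|_{L^{p}}$$ for $f\in L^p(\mathbb R^n)$.
   Context: $\mathbf{S}^{n-1}$ is the unit sphere of $\mathbb R^n$ with normalized Lebesgue measure $d\sigma$. $T_{\Omega,\alpha}f(x):=\int_{\mathbb R^n}\frac{\Omega(x-y)}{|x-y|^{n-\alpha}}f(y)\,dy$. $\|f\|_{\mathrm{BMO}}:=\sup_{B}\frac{1}{m(B)}\int_B|f(x)-f_B|\,dx$, the supremum over all balls $B\subset\mathbb R^n$, with $f_B:=\frac1{m(B)}\int_B f$. For $1\le s<\infty$, $\Omega$ satisfies condition $\mathfrak{D}_s$ if $\Omega\in L^s(\mathbf{S}^{n-1})$ is homogeneous of degree zero on $\mathbb R^n$ and $\int_0^1\frac{\omega_s(\delta)}{\delta}\,d\delta<\infty$, where $\omega_s(\delta):=\sup_{|\rho|<\delta}\big(\int_{\mathbf{S}^{n-1}}|\Omega(\rho x')-\Omega(x')|^s\,d\sigma(x')\big)^{1/s}$, $\rho$ ranging over rotations of $\mathbb R^n$ and $|\rho|:=\|\rho-I\|=\sup_{x'\in\mathbf{S}^{n-1}}|\rho x'-x'|$. Condition $\mathfrak{D}_\infty$ is defined likewise with $\Omega\in L^\infty(\mathbf{S}^{n-1})$ and $\omega_\infty(\delta):=\sup_{|\rho|<\delta,\,x'\in\mathbf{S}^{n-1}}|\Omega(\rho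 x')-\Omega(x')|$. *)

theory Defs
  imports "HOL-Analysis.Analysis"
begin

text \<open>
  Functions are complex valued (real-valued functions are the special case of functions with
  values in the reals). The spaces \<open>L\<^sup>p(\<real>\<^sup>n)\<close> are taken with respect to \<open>lebesgue\<close>, the completed
  Lebesgue measure.
\<close>

definition Lp_norm :: "'a measure \<Rightarrow> real \<Rightarrow> ('a \<Rightarrow> complex) \<Rightarrow> real" where
  "Lp_norm M p f = (\<integral>x. norm (f x) powr p \<partial>M) powr (1 / p)"

definition in_Lp :: "'a measure \<Rightarrow> ennreal \<Rightarrow> ('a \<Rightarrow> complex) \<Rightarrow> bool" where
  "in_Lp M p f \<longleftrightarrow> f \<in> borel_measurable M \<and>
     (if p = \<infinity> then \<exists>c. AE x in M. norm (f x) \<le> c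
      else integrable M (\<lambda>x. norm (f x) powr enn2real p))"

text \<open>
  The normalized surface measure of the unit sphere, as a measure on the ambient space that is
  concentrated on \<open>sphere 0 1\<close>: the image of the uniform distribution on the unit ball under
  the radial projection \<open>x \<mapsto> x / |x|\<close>, that is, \<open>\<sigma>(A) = m({t x | 0 < t < 1, x \<in> A}) / m(B(0,1))\<close>
  for Borel subsets \<open>A\<close> of the sphere, completed. (The origin, where \<open>sgn 0 = 0\<close>, is a null set.)
\<close>

definition sphere_measure :: "'a::euclidean_space measure" where
  "sphere_measure = completion (distr (uniform_measure lborel (ball 0 1)) borel sgn)"

definition rot_size :: "real^'n^'n \<Rightarrow> real" where
  "rot_size \<rho> = onorm (\<lambda>x. \<rho> *v x - x)"

text \<open>
  The moduli of continuity are extended real numbers because nothing in \<open>\<Omega> \<in> L\<^sup>\<infinity>\<close> bounds the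
  pointwise supremum in the case \<open>s = \<infinity>\<close>.
\<close>

definition dini_modulus :: "ennreal \<Rightarrow> (real^'n \<Rightarrow> complex) \<Rightarrow> real \<Rightarrow> ennreal" where
  "dini_modulus s \<Omega> \<delta> =
     (SUP \<rho> \<in> {\<rho>. rotation_matrix \<rho> \<and> rot_size \<rho> < \<delta>}.
        if s = \<infinity> then SUP x \<in> sphere 0 1. ennreal (norm (\<Omega> (\<rho> *v x) - \<Omega> x))
        else ennreal (Lp_norm sphere_measure (enn2real s) (\<lambda>x. \<Omega> (\<rho> *v x) - \<Omega> x)))"

definition homogeneous_degree_zero :: "('a::real_vector \<Rightarrow> complex) \<Rightarrow> bool" where
  "homogeneous_degree_zero \<Omega> \<longleftrightarrow> (\<forall>t>0. \<forall>x. \<Omega> (t *\<^sub>R x) = \<Omega> x)"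

definition dini_condition :: "ennreal \<Rightarrow> (real^'n \<Rightarrow> complex) \<Rightarrow> bool" where
  "dini_condition s \<Omega> \<longleftrightarrow>
     1 \<le> s \<and> in_Lp sphere_measure s \<Omega> \<and> homogeneous_degree_zero \<Omega> \<and>
     (\<integral>\<^sup>+ \<delta> \<in> {0<..<1}. dini_modulus s \<Omega> \<delta> / ennreal \<delta> \<partial>lborel) < \<infinity>"

text \<open>
  Points \<open>x\<close> at which the integral does not converge absolutely get the value \<open>0\<close>.
\<close>

definition frac_int_op :: "(real^'n \<Rightarrow> complex) \<Rightarrow> real \<Rightarrow> (real^'n \<Rightarrow> complex) \<Rightarrow> real^'n \<Rightarrow> complex" where
  "frac_int_op \<Omega> \<alpha> f x =
     (\<integral>y. \<Omega> (x - y) / of_real (norm (x - y) powr (real CARD('n) - \<alpha>)) * f y \<partial>lebesgue)"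

definition mean_on :: "'a::euclidean_space set \<Rightarrow> ('a \<Rightarrow> 'b::{banach, second_countable_topology}) \<Rightarrow> 'b" where
  "mean_on B g = (LINT x:B|lebesgue. g x) /\<^sub>R measure lebesgue B"

text \<open>
  A function that is not locally integrable has infinite BMO norm.
\<close>

definition bmo_norm :: "('a::euclidean_space \<Rightarrow> complex) \<Rightarrow> ennreal" where
  "bmo_norm g =
     (if \<forall>a r. 0 < r \<longrightarrow> set_integrable lebesgue (ball a r) g
      then SUP (a, r) \<in> UNIV \<times> {0<..}.
             ennreal (mean_on (ball a r) (\<lambda>x. norm (g x - mean_on (ball a r) g)))
      else \<infinity>)"

end

theory Submission
  imports Defs
begin

text \<open>
  By Hoelder the condition with exponent \<open>s\<close> implies the one with the dual exponent
  \<open>q = n/(n - \<alpha>)\<close> of \<open>p\<close>, for which \<open>|K|\<^sup>q = |\<Omega>|\<^sup>q / |x|\<^sup>n\<close> is scale invariant. On a ball \<open>B\<close> of radius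
  \<open>r\<close> the oscillation \<open>|T f x - T f x'|\<close> is averaged over both \<open>x\<close> and \<open>x'\<close>. The part of \<open>f\<close> near \<open>B\<close>
  only needs \<open>K \<in> L\<^sup>1\<close> locally. Far from \<open>B\<close> one needs, on the annulus \<open>|u| \<approx> R = 2\<^sup>k r\<close>, that the average
  of \<open>|\<Omega> u - \<Omega> v|\<^sup>q\<close> over \<open>|v - u| < 2 r\<close> is at most a constant times \<open>(\<omega>(2\<^sup>-\<^sup>k) + 2\<^sup>-\<^sup>k)\<^sup>q\<close>, and the Dini
  condition makes these bounds summable in \<open>k\<close>.

  To compare this average with rotations, let \<open>e\<close> be a coordinate axis along which \<open>u\<close> has a large
  component. The points \<open>v\<close> near \<open>u\<close> have the form \<open>|b|\<^sup>2 R\<^sub>b R\<^sub>e u\<close>, where \<open>R\<close> denotes reflections and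
  \<open>|b - e| \<le> C r/R\<close>, and the map \<open>b \<mapsto> v\<close> is Lipschitz. Hence the average over \<open>v\<close> is dominated by an
  average over the rotations \<open>R\<^sub>b R\<^sub>e\<close>, which do not depend on \<open>u\<close>, and Fubini's theorem applies.
\<close>

section \<open>Lipschitz change of variables\<close>

definition lip_const :: "'a::euclidean_space itself \<Rightarrow> real" where
  "lip_const _ = unit_ball_vol (real DIM('a)) * real DIM('a) ^ DIM('a)"

lemma emeasure_UN_le_nn_integral:
  assumes I: "countable I" and Y: "\<And>i. i \<in> I \<Longrightarrow> Y i \<in> sets M"
  shows "emeasure M (\<Union>i\<in>I. Y i) \<le> (\<integral>\<^sup>+i. emeasure M (Y i) \<partial>count_space I)"
proof -
  define Z where "Z i = Y i - (\<Union>j\<in>{j\<in>I. to_nat_on I j < to_nat_on I i}. Y j)" for i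
  have Z: "Z i \<in> sets M" if "i \<in> I" for i
    unfolding Z_def using Y I that by (intro sets.Diff sets.countable_UN') auto
  have "(\<Union>i\<in>I. Y i) \<subseteq> (\<Union>i\<in>I. Z i)"
  proof
    fix x assume "x \<in> (\<Union>i\<in>I. Y i)"
    then obtain i where "i \<in> I" "x \<in> Y i" by blast
    then obtain j where j: "j \<in> I \<and> x \<in> Y j"
      "\<And>k. k \<in> I \<and> x \<in> Y k \<Longrightarrow> to_nat_on I j \<le> to_nat_on I k"
      using ex_has_least_nat[of "\<lambda>i. i \<in> I \<and> x \<in> Y i" i "to_nat_on I"] by blast
    then have "x \<in> Z j" by (force simp: Z_def)
    then show "x \<in> (\<Union>i\<in>I. Z i)" using j by blast
  qed
  then have "emeasure M (\<Union>i\<in>I. Y i) \<le> emeasure M (\<Union>i\<in>I. Z i)"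
    using Z I by (intro emeasure_mono) (auto intro!: sets.countable_UN')
  also have "\<dots> = (\<integral>\<^sup>+i. emeasure M (Z i) \<partial>count_space I)"
  proof (rule emeasure_UN_countable[OF Z I])
    have "Z i \<inter> Z j = {}" if "i \<in> I" "j \<in> I" "to_nat_on I i < to_nat_on I j" for i j
      using that unfolding Z_def by blast
    moreover have "to_nat_on I i < to_nat_on I j \<or> to_nat_on I j < to_nat_on I i"
      if "i \<in> I" "j \<in> I" "i \<noteq> j" for i j
      using that I by (metis inj_onD inj_on_to_nat_on nat_neq_iff)
    ultimately show "disjoint_family_on Z I"
      unfolding disjoint_family_on_def by (metis Int_commute)
  qed
  also have "\<dots> \<le> (\<integral>\<^sup>+i. emeasure M (Y i) \<partial>count_space I)"
    using Y by (intro nn_integral_mono emeasure_mono) (auto simp: Z_def)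
  finally show ?thesis .
qed

text \<open>
  The bound \<open>measure_bounded_differentiable_image\<close> of the library is not available here: it needs a
  well-ordered index type. Both this bound and the invariance under rotations are only needed up
  to a constant.
\<close>

lemma emeasure_lipschitz_image_le:
  fixes f :: "'a::euclidean_space \<Rightarrow> 'a"
  assumes lip: "L-lipschitz_on S f" and L: "0 < L" and AS: "A \<subseteq> S" and bdd: "bounded A"
    and A: "A \<in> sets borel" and X: "X \<in> sets borel" "X \<subseteq> f ` A"
  shows "emeasure lborel X \<le> ennreal (lip_const TYPE('a) * L ^ DIM('a)) * emeasure lborel A"
proof -
  let ?c = "ennreal (lip_const TYPE('a) * L ^ DIM('a))"
  have "emeasure lborel X \<le> ?c * emeasure lborel A + ?c * ennreal e" if e: "e > 0" for e
  proof -
    obtain U where U: "open U" "A \<subseteq> U" "emeasure lborel (U - A) < ennreal e"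
      using outer_regular_lborel[OF A e] by blast
    obtain c0 where c0: "A \<subseteq> cbox (-c0) c0"
      using bounded_subset_cbox_symmetric[OF bdd] by blast
    define c where "c = norm c0 + 1"
    have c: "c > 0" by (simp add: c_def add_nonneg_pos)
    have sub: "A \<subseteq> cbox (- c *\<^sub>R One) (c *\<^sub>R One)"
    proof
      fix x assume "x \<in> A"
      then have "x \<in> cbox (-c0) c0" using c0 by blast
      then show "x \<in> cbox (- c *\<^sub>R One) (c *\<^sub>R One)"
        using Basis_le_norm[of _ c0] by (force simp: mem_box c_def)
    qed
    have ne: "box (- c *\<^sub>R One) (c *\<^sub>R One :: 'a) \<noteq> {}"
      using c by (auto simp: box_ne_empty)
    define g where "g x = (if x \<in> U then U else UNIV)" for x
    have g: "gauge g" using U(1) by (auto simp: gauge_def g_def)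
    obtain \<D> where D: "countable \<D>" "\<Union>\<D> \<subseteq> cbox (- c *\<^sub>R One) (c *\<^sub>R One)"
      "\<And>K. K \<in> \<D> \<Longrightarrow> interior K \<noteq> {} \<and> (\<exists>c d. K = cbox c d)"
      "pairwise (\<lambda>A B. interior A \<inter> interior B = {}) \<D>"
      "\<And>K. K \<in> \<D> \<Longrightarrow> \<exists>x \<in> A \<inter> K. K \<subseteq> g x"
      "\<And>u v. cbox u v \<in> \<D> \<Longrightarrow>
         \<exists>n. \<forall>i \<in> Basis. v \<bullet> i - u \<bullet> i = ((c *\<^sub>R One) \<bullet> i - (- c *\<^sub>R One) \<bullet> i) / 2^n"
      "A \<subseteq> \<Union>\<D>"
      using that by (rule covering_lemma[OF sub ne g])
    have DU: "K \<subseteq> U" if K: "K \<in> \<D>" for K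
    proof -
      obtain x where x: "x \<in> A" "K \<subseteq> g x" using D(5)[OF K] by blast
      then have "g x = U" using U(2) by (auto simp: g_def)
      then show ?thesis using x(2) by simp
    qed
    have D_bound: "\<exists>Y\<in>sets borel. f ` (K \<inter> A) \<subseteq> Y \<and> emeasure lborel Y \<le> ?c * emeasure lborel (interior K)"
      if K: "K \<in> \<D>" for K
    proof -
      obtain u v where uv: "K = cbox u v" using D(3)[OF K] by blast
      obtain n where n: "\<And>i. i \<in> Basis \<Longrightarrow> v \<bullet> i - u \<bullet> i = 2 * c / 2 ^ n"
        using D(6)[of u v] K uv by auto
      define t where "t = 2 * c / 2 ^ n"
      have t: "t > 0" using c by (simp add: t_def)
      obtain x where x: "x \<in> A" "x \<in> K" using D(5)[OF K] by blast
      have dist: "norm (y - x) \<le> t * real DIM('a)" if "y \<in> K" for y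
      proof -
        have "norm (y - x) \<le> (\<Sum>i\<in>Basis. \<bar>(y - x) \<bullet> i\<bar>)"
          by (rule norm_le_l1)
        also have "\<dots> \<le> (\<Sum>i\<in>(Basis::'a set). t)"
        proof (rule sum_mono)
          fix i :: 'a assume i: "i \<in> Basis"
          show "\<bar>(y - x) \<bullet> i\<bar> \<le> t"
          proof -
            have "u \<bullet> i \<le> y \<bullet> i \<and> y \<bullet> i \<le> v \<bullet> i" "u \<bullet> i \<le> x \<bullet> i \<and> x \<bullet> i \<le> v \<bullet> i"
              using that x(2) i unfolding uv mem_box by blast+
            then show ?thesis
              using n[OF i] unfolding t_def[symmetric] inner_diff_left by linarith
          qed
        qed
        also have "\<dots> = t * real DIM('a)" by simp
        finally show ?thesis .
      qed
      have "f ` (K \<inter> A) \<subseteq> cball (f x) (L * (t * real DIM('a)))"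
      proof clarify
        fix y assume y: "y \<in> K" "y \<in> A"
        have "dist (f x) (f y) \<le> L * dist x y"
          using lip x(1) y(2) AS by (auto intro: lipschitz_onD)
        also have "\<dots> \<le> L * (t * real DIM('a))"
          using dist[OF y(1)] L by (simp add: dist_norm norm_minus_commute)
        finally show "f y \<in> cball (f x) (L * (t * real DIM('a)))" by simp
      qed
      moreover have "emeasure lborel (cball (f x) (L * (t * real DIM('a)))) \<le> ?c * emeasure lborel (interior K)"
      proof -
        have "emeasure lborel (interior K) = ennreal (\<Prod>i\<in>(Basis::'a set). t)"
          unfolding uv interior_cbox
        proof (subst emeasure_lborel_box)
          show "u \<bullet> i \<le> v \<bullet> i" if "i \<in> Basis" for i
            using n[OF that] t unfolding t_def by linarith
          show "ennreal (\<Prod>i\<in>Basis. (v - u) \<bullet> i) = ennreal (\<Prod>i\<in>(Basis::'a set). t)"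
            by (intro arg_cong[of _ _ ennreal] prod.cong) (simp_all add: inner_diff_left n t_def)
        qed
        also have "\<dots> = ennreal (t ^ DIM('a))" by simp
        finally have "?c * emeasure lborel (interior K) = ennreal (lip_const TYPE('a) * L ^ DIM('a) * t ^ DIM('a))"
          using t by (simp add: ennreal_mult'')
        also have "\<dots> = emeasure lborel (cball (f x) (L * (t * real DIM('a))))"
          using L t by (subst emeasure_cball) (auto simp: lip_const_def power_mult_distrib mult_ac)
        finally show ?thesis by simp
      qed
      ultimately show ?thesis by (intro bexI[of _ "cball (f x) (L * (t * real DIM('a)))"]) auto
    qed
    then obtain Y where Y: "\<And>K. K \<in> \<D> \<Longrightarrow> Y K \<in> sets borel" "\<And>K. K \<in> \<D> \<Longrightarrow> f ` (K \<inter> A) \<subseteq> Y K"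
      "\<And>K. K \<in> \<D> \<Longrightarrow> emeasure lborel (Y K) \<le> ?c * emeasure lborel (interior K)"
      by metis
    have Xsub: "X \<subseteq> (\<Union>K\<in>\<D>. Y K)"
    proof
      fix z assume "z \<in> X"
      then obtain a where a: "a \<in> A" "z = f a" using X(2) by blast
      then obtain K where "K \<in> \<D>" "a \<in> K" using D(7) by blast
      then show "z \<in> (\<Union>K\<in>\<D>. Y K)" using Y(2) a by blast
    qed
    have "emeasure lborel X \<le> emeasure lborel (\<Union>K\<in>\<D>. Y K)"
      using Xsub Y(1) D(1) by (intro emeasure_mono) (auto intro!: sets.countable_UN')
    also have "\<dots> \<le> (\<integral>\<^sup>+K. emeasure lborel (Y K) \<partial>count_space \<D>)"
      using Y(1) D(1) by (intro emeasure_UN_le_nn_integral) auto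
    also have "\<dots> \<le> (\<integral>\<^sup>+K. ?c * emeasure lborel (interior K) \<partial>count_space \<D>)"
      using Y(3) by (intro nn_integral_mono) auto
    also have "\<dots> = ?c * (\<integral>\<^sup>+K. emeasure lborel (interior K) \<partial>count_space \<D>)"
      by (rule nn_integral_cmult) simp
    also have "(\<integral>\<^sup>+K. emeasure lborel (interior K) \<partial>count_space \<D>) = emeasure lborel (\<Union>K\<in>\<D>. interior K)"
      using D(1,4) by (intro emeasure_UN_countable[symmetric])
        (auto simp: disjoint_family_on_def pairwise_def)
    also have "?c * \<dots> \<le> ?c * emeasure lborel U"
      using DU U(1)
      by (intro mult_left_mono emeasure_mono UN_least order_trans[OF interior_subset]) auto
    also have "emeasure lborel U = emeasure lborel A + emeasure lborel (U - A)"
      using U(1,2) A by (subst plus_emeasure) (auto simp: Un_absorb1)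
    also have "?c * \<dots> \<le> ?c * (emeasure lborel A + ennreal e)"
      using U(3) by (intro mult_left_mono add_left_mono) auto
    finally show ?thesis by (simp add: distrib_left)
  qed
  note * = this
  show ?thesis
  proof (rule ennreal_le_epsilon)
    fix e :: real assume e: "e > 0"
    define r where "r = lip_const TYPE('a) * L ^ DIM('a)"
    have r: "r > 0" using L by (simp add: r_def lip_const_def)
    show "emeasure lborel X \<le> ennreal (lip_const TYPE('a) * L ^ DIM('a)) * emeasure lborel A + ennreal e"
      using *[of "e / r"] e r by (simp add: r_def[symmetric] ennreal_mult[symmetric])
  qed
qed

lemma nn_integral_lipschitz_le:
  fixes f :: "'a::euclidean_space \<Rightarrow> 'a"
  assumes lip: "L-lipschitz_on S f" and L: "0 < L" and bdd: "bounded S"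
    and S: "S \<in> sets borel" and B: "B \<in> sets borel" "B \<subseteq> f ` S"
    and f: "f \<in> borel_measurable borel" and F: "F \<in> borel_measurable borel"
  shows "(\<integral>\<^sup>+x\<in>B. F x \<partial>lborel) \<le>
    ennreal (lip_const TYPE('a) * L ^ DIM('a)) * (\<integral>\<^sup>+x\<in>S. F (f x) \<partial>lborel)"
proof -
  let ?c = "ennreal (lip_const TYPE('a) * L ^ DIM('a))"
  note [measurable] = S B(1) f F
  define M where "M = density lborel (indicator B :: 'a \<Rightarrow> ennreal)"
  define N where "N = distr (density lborel (\<lambda>x. ?c * indicator S x)) borel f"
  have "emeasure M X \<le> emeasure N X" if [measurable]: "X \<in> sets borel" for X
  proof -
    have "emeasure M X = emeasure lborel (B \<inter> X)"
      unfolding M_def by (subst emeasure_density) (auto simp: indicator_inter_arith[symmetric])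
    also have "\<dots> \<le> ?c * emeasure lborel (S \<inter> f -` X)"
    proof (rule emeasure_lipschitz_image_le[OF lip L])
      show "S \<inter> f -` X \<in> sets borel" using measurable_sets[OF f that] S by auto
      show "B \<inter> X \<subseteq> f ` (S \<inter> f -` X)" using B(2) by blast
    qed (use bdd B(1) that in \<open>auto intro: bounded_subset\<close>)
    also have "\<dots> = emeasure N X"
    proof -
      have [measurable]: "f -` X \<in> sets borel" using measurable_sets[OF f that] by auto
      show ?thesis
        unfolding N_def by (subst emeasure_distr, simp, simp, subst emeasure_density)
          (auto simp: mult.assoc indicator_inter_arith[symmetric] nn_integral_cmult_indicator)
    qed
    finally show ?thesis .
  qed
  then have "M \<le> N"
    by (subst le_measure) (auto simp: M_def N_def le_fun_def emeasure_notin_sets)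
  then have "nn_integral M F \<le> nn_integral N F"
    by (intro nn_integral_mono_measure) (auto simp: M_def N_def)
  also have "nn_integral M F = (\<integral>\<^sup>+x\<in>B. F x \<partial>lborel)"
    unfolding M_def by (subst nn_integral_density) (auto simp: mult.commute)
  also have "nn_integral N F = (\<integral>\<^sup>+x. ?c * (F (f x) * indicator S x) \<partial>lborel)"
    unfolding N_def by (subst nn_integral_distr, simp, simp, subst nn_integral_density) (auto simp: mult_ac)
  also have "\<dots> = ?c * (\<integral>\<^sup>+x\<in>S. F (f x) \<partial>lborel)"
    by (subst nn_integral_cmult) auto
  finally show ?thesis .
qed

section \<open>Reflections\<close>

lemma nn_integral_lborel_affine:
  fixes F :: "'a::euclidean_space \<Rightarrow> ennreal"
  assumes c: "c \<noteq> 0" and [measurable]: "F \<in> borel_measurable borel"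
  shows "(\<integral>\<^sup>+x. F x \<partial>lborel) = ennreal (\<bar>c\<bar> ^ DIM('a)) * (\<integral>\<^sup>+x. F (t + c *\<^sub>R x) \<partial>lborel)"
proof -
  have "(\<integral>\<^sup>+x. F x \<partial>lborel)
      = (\<integral>\<^sup>+x. F x \<partial>density (distr lborel borel (\<lambda>x. t + c *\<^sub>R x)) (\<lambda>_. \<bar>c\<bar>^DIM('a)))"
    using lborel_affine[OF c, of t] by simp
  also have "\<dots> = ennreal (\<bar>c\<bar> ^ DIM('a)) * (\<integral>\<^sup>+x. F (t + c *\<^sub>R x) \<partial>lborel)"
    by (subst nn_integral_density) (auto simp: nn_integral_distr nn_integral_cmult)
  finally show ?thesis .
qed

lemma nn_integral_lborel_reflect:
  fixes F :: "'a::euclidean_space \<Rightarrow> ennreal"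
  assumes "F \<in> borel_measurable borel"
  shows "(\<integral>\<^sup>+y. F (x - y) \<partial>lborel) = (\<integral>\<^sup>+y. F y \<partial>lborel)"
  using nn_integral_lborel_affine[of "-1" F x] assms by simp

lemma nn_integral_lborel_translate:
  fixes F :: "'a::euclidean_space \<Rightarrow> ennreal"
  assumes "F \<in> borel_measurable borel"
  shows "(\<integral>\<^sup>+y. F (y - x) \<partial>lborel) = (\<integral>\<^sup>+y. F y \<partial>lborel)"
  using nn_integral_lborel_affine[of 1 F "-x"] assms by simp

lemma nn_integral_ball_homogeneous:
  fixes F :: "'a::euclidean_space \<Rightarrow> ennreal"
  assumes hom: "\<And>t x. t > 0 \<Longrightarrow> F (t *\<^sub>R x) = F x" and [measurable]: "F \<in> borel_measurable borel"
    and r: "r > 0"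
  shows "(\<integral>\<^sup>+x\<in>ball 0 r. F x \<partial>lborel) = ennreal (r ^ DIM('a)) * (\<integral>\<^sup>+x\<in>ball 0 1. F x \<partial>lborel)"
proof -
  have [measurable]: "ball (0::'a) r \<in> sets borel" by simp
  have meas: "(\<lambda>x. F x * indicator (ball 0 r) x) \<in> borel_measurable borel" by measurable
  have "(\<integral>\<^sup>+x\<in>ball 0 r. F x \<partial>lborel)
      = ennreal (r ^ DIM('a)) * (\<integral>\<^sup>+x. F (r *\<^sub>R x) * indicator (ball 0 r) (r *\<^sub>R x) \<partial>lborel)"
    using nn_integral_lborel_affine[OF _ meas, of r 0] r by simp
  also have "(\<lambda>x. F (r *\<^sub>R x) * indicator (ball 0 r) (r *\<^sub>R x)) = (\<lambda>x. F x * indicator (ball 0 1) x)"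
    using r by (auto simp: hom indicator_def fun_eq_iff)
  finally show ?thesis .
qed

definition householder :: "'a::real_inner \<Rightarrow> 'a \<Rightarrow> 'a" where
  "householder b x = x - (2 * (b \<bullet> x) / (b \<bullet> b)) *\<^sub>R b"

lemma linear_householder: "linear (householder b)"
  unfolding householder_def
  by (rule linearI) (simp_all add: inner_add_right algebra_simps add_divide_distrib)

lemma norm_householder [simp]: "norm (householder b x) = norm x"
proof -
  have "householder b x \<bullet> householder b x = x \<bullet> x"
    by (cases "b = 0") (simp_all add: householder_def inner_diff_left inner_diff_right inner_commute field_simps power2_eq_square)
  then show ?thesis by (simp add: norm_eq_sqrt_inner)
qed

lemma householder_involution [simp]: "householder b (householder b x) = x"
  by (cases "b = 0") (simp_all add: householder_def inner_diff_right algebra_simps)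

lemma norm_householder_diff_le:
  assumes e: "norm e = 1"
  shows "norm (householder b x - householder e x) \<le> 8 * norm (b - e) * norm x"
proof (cases "b = 0")
  case True
  have "norm (householder b x - householder e x) \<le> norm x + norm x"
    by (intro order_trans[OF norm_triangle_ineq4]) simp
  also have "\<dots> \<le> 8 * norm x" by simp
  finally show ?thesis using True e by simp
next
  case False
  define c where "c = b /\<^sub>R norm b"
  have c: "norm c = 1" using False by (simp add: c_def)
  have hb: "householder b x = householder c x"
    using False by (simp add: householder_def c_def field_simps power2_norm_eq_inner[symmetric] power2_eq_square)
  have "norm (c - e) \<le> norm (c - b) + norm (b - e)"
    by (metis diff_add_cancel add_diff_eq norm_triangle_ineq)
  moreover have "c - b = (1 - norm b) *\<^sub>R c"
    using False by (simp add: c_def algebra_simps)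
  then have "norm (c - b) = \<bar>norm e - norm b\<bar>" using c e by simp
  then have "norm (c - b) \<le> norm (b - e)"
    using norm_triangle_ineq3[of e b] by (simp add: norm_minus_commute)
  ultimately have ce: "norm (c - e) \<le> 2 * norm (b - e)" by simp
  have "householder c x - householder e x = - (2 * ((c - e) \<bullet> x)) *\<^sub>R c - (2 * (e \<bullet> x)) *\<^sub>R (c - e)"
    using c e by (simp add: householder_def norm_eq_1 inner_diff_left algebra_simps)
  also have "norm \<dots> \<le> 2 * \<bar>(c - e) \<bullet> x\<bar> + 2 * \<bar>e \<bullet> x\<bar> * norm (c - e)"
    using c by (intro order_trans[OF norm_triangle_ineq4]) simp
  also have "\<dots> \<le> 2 * (norm (c - e) * norm x) + 2 * (norm e * norm x) * norm (c - e)"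
    by (intro add_mono mult_left_mono mult_right_mono Cauchy_Schwarz_ineq2) auto
  also have "\<dots> = 4 * norm (c - e) * norm x" using e by simp
  also have "\<dots> \<le> 4 * (2 * norm (b - e)) * norm x"
    using ce by (intro mult_left_mono mult_right_mono) auto
  finally show ?thesis using hb by simp
qed

lemma det_householder:
  fixes b :: "real^'n"
  assumes b: "b \<noteq> 0"
  shows "det (matrix (householder b)) = -1"
proof -
  obtain k :: 'n where True by simp
  have "norm (b /\<^sub>R norm b) = 1" using b by simp
  then obtain A where A: "orthogonal_matrix A" "A *v axis k 1 = b /\<^sub>R norm b"
    using orthogonal_matrix_exists_basis by blast
  let ?e = "axis k 1 :: real^'n"
  define D :: "real^'n^'n" where "D = matrix (householder ?e)"
  have D: "D $ i $ j = (if i = j then if i = k then -1 else 1 else 0)" for i j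
  proof -
    have "D $ i $ j = axis j 1 $ i - 2 * (?e \<bullet> axis j 1) * ?e $ i"
      by (simp add: D_def matrix_def householder_def)
    also have "?e \<bullet> axis j 1 = (if k = j then 1 else 0)"
      by (simp add: inner_axis_axis)
    finally show ?thesis by (auto simp: axis_def)
  qed
  have AtA: "transpose A ** A = mat 1" "A ** transpose A = mat 1"
    using A(1) by (auto simp: orthogonal_matrix_def)
  have inner: "(A *v u) \<bullet> (A *v w) = u \<bullet> w" for u w
    using A(1) orthogonal_transformation_matrix[of "(*v) A"]
    by (simp add: orthogonal_transformation_def matrix_vector_mul_linear)
  have "householder b x = (A ** D ** transpose A) *v x" for x
  proof -
    define z where "z = transpose A *v x"
    have x: "x = A *v z"
      unfolding z_def matrix_vector_mul_assoc AtA by simp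
    have bA: "b = norm b *\<^sub>R (A *v ?e)" using A(2) b by simp
    have "householder b x = householder (A *v ?e) x"
      by (subst bA) (use b in \<open>simp add: householder_def field_simps\<close>)
    also have "\<dots> = A *v householder ?e z"
      unfolding x by (simp add: householder_def inner matrix_vector_mult_diff_distrib matrix_vector_mult_scaleR)
    also have "householder ?e z = D *v z"
      unfolding D_def by (simp add: matrix_works linear_householder)
    finally show ?thesis unfolding z_def by (simp only: matrix_vector_mul_assoc matrix_mul_assoc)
  qed
  then have "matrix (householder b) = A ** D ** transpose A"
    by (metis matrix_of_matrix_vector_mul ext)
  then have "det (matrix (householder b)) = det (A ** transpose A) * det D"
    by (simp add: det_mul)
  also have "det D = (\<Prod>i\<in>UNIV. D $ i $ i)"
    by (rule det_diagonal) (auto simp: D)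
  also have "\<dots> = (\<Prod>i\<in>UNIV. if i = k then -1 else 1)"
    by (intro prod.cong) (auto simp: D)
  also have "\<dots> = -1" by simp
  finally show ?thesis by (simp add: AtA)
qed

text \<open>
  As a quadratic polynomial in \<open>b\<close> this map \<open>Q\<close> satisfies \<open>Q b - Q c = DQ(m) (b - c)\<close> with
  \<open>m = (b + c)/2\<close>, and \<open>DQ(m)\<close> is \<open>- 2 (m \<bullet> y)\<close> times the identity plus an antisymmetric map.
\<close>

definition householder_quad :: "'a::real_inner \<Rightarrow> 'a \<Rightarrow> 'a" where
  "householder_quad y b = (b \<bullet> b) *\<^sub>R y - (2 * (b \<bullet> y)) *\<^sub>R b"

lemma householder_quad_eq: "householder_quad y b = (b \<bullet> b) *\<^sub>R householder b y"
  by (cases "b = 0") (simp_all add: householder_quad_def householder_def algebra_simps)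

lemma householder_quad_diff:
  "householder_quad y b - householder_quad y c =
     ((b + c) \<bullet> (b - c)) *\<^sub>R y - ((b - c) \<bullet> y) *\<^sub>R (b + c) - ((b + c) \<bullet> y) *\<^sub>R (b - c)"
proof -
  have two: "(2 * r) *\<^sub>R x = r *\<^sub>R x + r *\<^sub>R x" for r :: real and x :: 'a
    unfolding mult_2 by (rule scaleR_add_left)
  have "(b + c) \<bullet> (b - c) = b \<bullet> b - c \<bullet> c"
    by (simp add: inner_add_left inner_diff_right inner_commute[of c b])
  moreover have "((b - c) \<bullet> y) *\<^sub>R (b + c) + ((b + c) \<bullet> y) *\<^sub>R (b - c) =
      (2 * (b \<bullet> y)) *\<^sub>R b - (2 * (c \<bullet> y)) *\<^sub>R c"
    unfolding two inner_add_left inner_diff_left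
    by (simp add: scaleR_add_left scaleR_diff_left scaleR_add_right scaleR_diff_right)
  ultimately show ?thesis
    by (simp add: householder_quad_def scaleR_diff_left algebra_simps)
qed

lemma householder_quad_expanding:
  "\<bar>(b + c) \<bullet> y\<bar> * norm (b - c) \<le> norm (householder_quad y b - householder_quad y c)"
proof (cases "b = c")
  case False
  have "(householder_quad y b - householder_quad y c) \<bullet> (b - c) = - ((b + c) \<bullet> y) * (norm (b - c))\<^sup>2"
    unfolding householder_quad_diff inner_diff_left[of _ _ "b - c"] inner_scaleR_left power2_norm_eq_inner
    by (simp add: inner_commute algebra_simps)
  then have "\<bar>(b + c) \<bullet> y\<bar> * (norm (b - c))\<^sup>2 = \<bar>(householder_quad y b - householder_quad y c) \<bullet> (b - c)\<bar>"
    by (simp add: abs_mult)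
  also have "\<dots> \<le> norm (householder_quad y b - householder_quad y c) * norm (b - c)"
    by (rule Cauchy_Schwarz_ineq2)
  finally show ?thesis using False by (simp add: power2_eq_square)
qed simp

lemma householder_quad_lipschitz:
  "norm (householder_quad y b - householder_quad y c) \<le> 3 * norm (b + c) * norm y * norm (b - c)"
proof -
  have "norm (householder_quad y b - householder_quad y c) \<le>
     norm (((b + c) \<bullet> (b - c)) *\<^sub>R y) + norm (((b - c) \<bullet> y) *\<^sub>R (b + c)) + norm (((b + c) \<bullet> y) *\<^sub>R (b - c))"
    unfolding householder_quad_diff
    by (intro order_trans[OF norm_triangle_ineq4] add_right_mono norm_triangle_ineq4)
  also have "\<dots> \<le> (norm (b + c) * norm (b - c)) * norm y + (norm (b - c) * norm y) * norm (b + c)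
     + (norm (b + c) * norm y) * norm (b - c)"
    unfolding norm_scaleR
    by (intro add_mono mult_right_mono Cauchy_Schwarz_ineq2) auto
  finally show ?thesis by (simp add: mult_ac)
qed

lemma householder_quad_surj:
  fixes y v e :: "'a::euclidean_space"
  assumes dim: "2 \<le> DIM('a)" and e: "e \<bullet> y \<noteq> 0" and v: "v \<noteq> 0"
  obtains b where "householder_quad y b = v" "norm (b - e) \<le> norm (v - householder_quad y e) / \<bar>e \<bullet> y\<bar>"
proof -
  have y: "y \<noteq> 0" using e by auto
  define w where "w = norm v *\<^sub>R y - norm y *\<^sub>R v"
  obtain b where b: "householder_quad y b = v" "0 \<le> (b \<bullet> y) * (e \<bullet> y)"
  proof (cases "w = 0")
    case True
    obtain z where z: "z \<noteq> 0" "y \<bullet> z = 0"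
      using orthogonal_to_vector_exists[OF dim, of y] by (auto simp: orthogonal_def)
    define b where "b = (sqrt (norm v / norm y) / norm z) *\<^sub>R z"
    have "norm b = sqrt (norm v / norm y)" using z by (simp add: b_def)
    then have "b \<bullet> b = norm v / norm y" by (simp flip: power2_norm_eq_inner)
    moreover have "b \<bullet> y = 0" using z by (simp add: b_def inner_commute)
    moreover have "(norm v / norm y) *\<^sub>R y = v"
    proof -
      have "(norm v / norm y) *\<^sub>R y = (1 / norm y) *\<^sub>R (norm v *\<^sub>R y)" by simp
      also have "norm v *\<^sub>R y = norm y *\<^sub>R v" using True by (simp add: w_def)
      finally show ?thesis using y by simp
    qed
    ultimately show ?thesis by (intro that[of b]) (auto simp: householder_quad_def)
  next
    case False
    define k where "k = sgn (e \<bullet> y) * (sqrt (norm v / norm y) / norm w)"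
    define b where "b = k *\<^sub>R w"
    have kk: "k * k * (w \<bullet> w) = norm v / norm y"
    proof -
      have "norm (k *\<^sub>R w) = sqrt (norm v / norm y)" using False e by (simp add: k_def abs_mult)
      then have "(norm (k *\<^sub>R w))\<^sup>2 = norm v / norm y" by simp
      then show ?thesis unfolding power2_norm_eq_inner by (simp add: mult_ac)
    qed
    have ww: "w \<bullet> w = 2 * norm v * (w \<bullet> y)"
    proof -
      have "w \<bullet> w = norm v * (norm v * (y \<bullet> y)) - 2 * (norm v * (norm y * (v \<bullet> y))) + norm y * (norm y * (v \<bullet> v))"
        by (simp add: w_def inner_diff_left inner_diff_right inner_commute algebra_simps)
      also have "\<dots> = 2 * norm v * (w \<bullet> y)"
        by (simp add: w_def inner_diff_left dot_square_norm power2_eq_square algebra_simps)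
      finally show ?thesis .
    qed
    have wy: "w \<bullet> y > 0"
    proof -
      have "0 < 2 * norm v * (w \<bullet> y)" unfolding ww[symmetric] using False by simp
      then show ?thesis using v by (simp add: zero_less_mult_iff)
    qed
    have "householder_quad y b = (k * k * (w \<bullet> w)) *\<^sub>R y - (k * k * (2 * (w \<bullet> y))) *\<^sub>R w"
      unfolding householder_quad_def b_def inner_scaleR_left inner_scaleR_right scaleR_scaleR
      by (simp add: mult_ac)
    also have "k * k * (2 * (w \<bullet> y)) = (k * k * (w \<bullet> w)) / norm v"
      using ww v by simp
    also have "(k * k * (w \<bullet> w)) *\<^sub>R y - ((k * k * (w \<bullet> w)) / norm v) *\<^sub>R w = v"
      unfolding kk unfolding w_def scaleR_diff_right scaleR_scaleR using v y by simp
    finally have "householder_quad y b = v" .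
    moreover have "0 \<le> (b \<bullet> y) * (e \<bullet> y)"
      using wy by (simp add: b_def k_def sgn_if zero_le_mult_iff mult_le_0_iff)
    ultimately show ?thesis by (rule that)
  qed
  have "\<bar>e \<bullet> y\<bar> \<le> \<bar>(b + e) \<bullet> y\<bar>"
    using b(2) by (auto simp: inner_add_left zero_le_mult_iff abs_if)
  then have "\<bar>e \<bullet> y\<bar> * norm (b - e) \<le> norm (v - householder_quad y e)"
    using householder_quad_expanding[of b e y] b(1)
      mult_right_mono[of "\<bar>e \<bullet> y\<bar>" "\<bar>(b + e) \<bullet> y\<bar>" "norm (b - e)"] by simp
  then have "norm (b - e) \<le> norm (v - householder_quad y e) / \<bar>e \<bullet> y\<bar>"
    using e by (simp add: field_simps)
  then show ?thesis using that b(1) by blast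
qed

section \<open>Averages of a homogeneous function and rotations\<close>

lemma borel_measurable_householder [measurable]:
  fixes f g :: "'b \<Rightarrow> 'a::euclidean_space"
  assumes [measurable]: "f \<in> borel_measurable M" "g \<in> borel_measurable M"
  shows "(\<lambda>x. householder (f x) (g x)) \<in> borel_measurable M"
  unfolding householder_def by measurable

lemma borel_measurable_householder_quad [measurable]:
  fixes f g :: "'b \<Rightarrow> 'a::euclidean_space"
  assumes [measurable]: "f \<in> borel_measurable M" "g \<in> borel_measurable M"
  shows "(\<lambda>x. householder_quad (f x) (g x)) \<in> borel_measurable M"
  unfolding householder_quad_def by measurable

lemma householder_product_rotation:
  fixes b e :: "real^'n"
  assumes b: "b \<noteq> 0" and e: "norm e = 1"
  obtains \<rho> where "rotation_matrix \<rho>" "rot_size \<rho> \<le> 8 * norm (b - e)"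
    "\<And>x. \<rho> *v x = householder b (householder e x)"
proof
  define \<rho> where "\<rho> = matrix (householder b) ** matrix (householder e)"
  show \<rho>: "\<rho> *v x = householder b (householder e x)" for x
    unfolding \<rho>_def matrix_vector_mul_assoc[symmetric]
    by (simp add: matrix_works linear_householder)
  have "e \<noteq> 0" using e by auto
  have orth: "orthogonal_matrix (matrix (householder c))" for c :: "real^'n"
    using orthogonal_transformation_matrix[of "householder c"]
    by (simp add: orthogonal_transformation linear_householder)
  then show "rotation_matrix \<rho>"
    using b \<open>e \<noteq> 0\<close> by (simp add: rotation_matrix_def \<rho>_def orthogonal_matrix_mul det_mul det_householder)
  show "rot_size \<rho> \<le> 8 * norm (b - e)"
    unfolding rot_size_def
  proof (rule onorm_le)
    fix x
    show "norm (\<rho> *v x - x) \<le> 8 * norm (b - e) * norm x"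
      using norm_householder_diff_le[OF e, of b "householder e x"] by (simp add: \<rho>)
  qed
qed

lemma ex_large_component:
  fixes u :: "real^'n"
  shows "\<exists>i. norm u \<le> real CARD('n) * \<bar>u $ i\<bar>"
proof (rule ccontr)
  assume "\<not> ?thesis"
  then have less: "\<bar>u $ i\<bar> < norm u / real CARD('n)" for i
    by (auto simp: not_le field_simps)
  have "norm u \<le> (\<Sum>i\<in>UNIV. \<bar>u $ i\<bar>)" by (rule norm_le_l1_cart)
  also have "\<dots> < (\<Sum>i\<in>(UNIV::'n set). norm u / real CARD('n))"
    by (rule sum_strict_mono) (use less in auto)
  finally show False by simp
qed

definition rot_const :: "'a::euclidean_space itself \<Rightarrow> real" where
  "rot_const _ = lip_const TYPE('a) * 36 ^ DIM('a) *
     (real DIM('a) * (unit_ball_vol (real DIM('a)) * (4 * real DIM('a)) ^ DIM('a) * 4 ^ DIM('a)))"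

lemma rot_const_nonneg: "0 \<le> rot_const TYPE('a::euclidean_space)"
  by (simp add: rot_const_def lip_const_def)

text \<open>
  The lower bound on \<open>d\<close> does not affect its summability; it makes \<open>d\<close> positive and absorbs the
  error from the variation of the factor \<open>|x|\<close> to the power \<open>\<alpha> - n\<close>.
\<close>

locale dini_kernel =
  fixes W :: "real^'n \<Rightarrow> complex" and \<alpha> q M :: real and d :: "nat \<Rightarrow> real"
  assumes dim: "2 \<le> CARD('n)" and \<alpha>: "0 < \<alpha>" "\<alpha> < real CARD('n)"
    and q_def: "q = real CARD('n) / (real CARD('n) - \<alpha>)"
    and W [measurable]: "W \<in> borel_measurable borel"
    and hom: "\<And>t x. t > 0 \<Longrightarrow> W (t *\<^sub>R x) = W x"
    and M: "0 \<le> M" "(\<integral>\<^sup>+u\<in>ball 0 1. ennreal (norm (W u) powr q) \<partial>lborel) \<le> ennreal M"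
    and d: "\<And>k. (1/2) ^ k \<le> d k" "summable d"
    and modulus: "\<And>k \<rho>. rotation_matrix \<rho> \<Longrightarrow> rot_size \<rho> < (1/2) ^ Suc k \<Longrightarrow>
      (\<integral>\<^sup>+u\<in>ball 0 1. ennreal (norm (W (\<rho> *v u) - W u) powr q) \<partial>lborel) \<le> ennreal (d k powr q)"
begin

lemma q_gt_1: "1 < q"
  using \<alpha> by (simp add: q_def field_simps)

lemma d_pos: "0 < d k"
  using d(1)[of k] by (meson less_le_trans zero_less_divide_1_iff zero_less_numeral zero_less_power)

lemma inner_average_le_rotations:
  fixes u :: "real^'n"
  assumes r: "0 < r" and R: "64 * real CARD('n) * r < R" and u: "R / 2 \<le> norm u" "norm u \<le> 3 * R"
  shows "(\<integral>\<^sup>+v\<in>ball u (2 * r). ennreal (norm (W u - W v) powr q) \<partial>lborel) \<le>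
    ennreal (lip_const TYPE(real^'n) * (36 * R) ^ CARD('n)) *
      (\<Sum>i\<in>UNIV. \<integral>\<^sup>+b\<in>cball (axis i 1) (4 * real CARD('n) * r / R).
         ennreal (norm (W u - W (householder b (householder (axis i 1) u))) powr q) \<partial>lborel)"
proof -
  define \<tau> where "\<tau> = 4 * real CARD('n) * r / R"
  have "0 < 64 * real CARD('n) * r" using r by simp
  then have R0: "R > 0" using R by linarith
  have n1: "real CARD('n) \<ge> 1" using dim by linarith
  have rR: "64 * r < R"
  proof -
    have "64 * r * 1 \<le> 64 * r * real CARD('n)" using n1 r by (intro mult_left_mono) auto
    then show ?thesis using R by (simp add: mult_ac)
  qed
  have \<tau>: "0 < \<tau>" "\<tau> < 1" using R R0 r by (auto simp: \<tau>_def field_simps)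
  obtain i where i: "norm u \<le> real CARD('n) * \<bar>u $ i\<bar>" using ex_large_component by blast
  define e :: "real^'n" where "e = axis i 1"
  have e: "norm e = 1" by (simp add: e_def)
  define y where "y = householder e u"
  have ey: "e \<bullet> y = - (u $ i)"
    using e by (simp add: y_def householder_def inner_diff_right norm_eq_1 e_def inner_axis')
  have ui: "\<bar>u $ i\<bar> \<ge> R / (2 * real CARD('n))"
    using i u(1) by (simp add: field_simps)
  have ui0: "\<bar>u $ i\<bar> > 0"
    using ui R0 by (smt (verit) zero_less_card_finite of_nat_0_less_iff divide_pos_pos mult_pos_pos)
  have Phi_e: "householder_quad y e = u"
    using e by (simp add: householder_quad_eq y_def norm_eq_1)
  let ?S = "cball e \<tau>"
  have lip: "(36 * R)-lipschitz_on ?S (householder_quad y)"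
  proof (rule lipschitz_onI)
    fix b c assume bc: "b \<in> ?S" "c \<in> ?S"
    have "norm b \<le> norm e + norm (b - e)" by (metis add.commute diff_add_cancel norm_triangle_ineq)
    moreover have "norm c \<le> norm e + norm (c - e)" by (metis add.commute diff_add_cancel norm_triangle_ineq)
    ultimately have "norm (b + c) \<le> 4"
      using bc e \<tau> norm_triangle_ineq[of b c] by (simp add: dist_norm norm_minus_commute)
    then have "3 * norm (b + c) * norm y * norm (b - c) \<le> 3 * 4 * (3 * R) * norm (b - c)"
      using u(2) R0 by (intro mult_right_mono mult_mono) (auto simp: y_def)
    then show "dist (householder_quad y b) (householder_quad y c) \<le> 36 * R * dist b c"
      using householder_quad_lipschitz[of y b c] unfolding dist_norm by linarith
  qed (use R0 in simp)
  have sub: "ball u (2 * r) \<subseteq> householder_quad y ` ?S"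
  proof
    fix v assume v: "v \<in> ball u (2 * r)"
    have "norm u \<le> norm (v - u) + norm v" by (metis norm_triangle_sub norm_minus_commute add.commute)
    then have v0: "v \<noteq> 0" using v u(1) rR r by (auto simp: dist_norm)
    have "e \<bullet> y \<noteq> 0" using ey ui0 by simp
    then obtain b where b: "householder_quad y b = v"
      "norm (b - e) \<le> norm (v - householder_quad y e) / \<bar>e \<bullet> y\<bar>"
      using householder_quad_surj[of e y v] v0 dim by auto
    note b(2)
    also have "norm (v - householder_quad y e) / \<bar>e \<bullet> y\<bar> \<le> (2 * r) / (R / (2 * real CARD('n)))"
      unfolding Phi_e ey abs_minus_cancel
      using v ui R0 r by (intro frac_le) (auto simp: dist_norm norm_minus_commute)
    also have "\<dots> = \<tau>" by (simp add: \<tau>_def)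
    finally have "b \<in> ?S" by (simp add: dist_norm norm_minus_commute)
    then show "v \<in> householder_quad y ` ?S" using b(1) by blast
  qed
  have "(\<integral>\<^sup>+v\<in>ball u (2 * r). ennreal (norm (W u - W v) powr q) \<partial>lborel) \<le>
      ennreal (lip_const TYPE(real^'n) * (36 * R) ^ DIM(real^'n)) *
      (\<integral>\<^sup>+b\<in>?S. ennreal (norm (W u - W (householder_quad y b)) powr q) \<partial>lborel)"
    using R0 by (intro nn_integral_lipschitz_le[OF lip _ _ _ _ sub]) auto
  also have "(\<integral>\<^sup>+b\<in>?S. ennreal (norm (W u - W (householder_quad y b)) powr q) \<partial>lborel) =
      (\<integral>\<^sup>+b\<in>?S. ennreal (norm (W u - W (householder b (householder e u))) powr q) \<partial>lborel)"
  proof (intro nn_integral_cong)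
    fix b
    show "ennreal (norm (W u - W (householder_quad y b)) powr q) * indicator ?S b =
      ennreal (norm (W u - W (householder b (householder e u))) powr q) * indicator ?S b"
    proof (cases "b \<in> ?S")
      case True
      then have "b \<noteq> 0" using \<tau> e by (auto simp: dist_norm)
      then have "W (householder_quad y b) = W (householder b y)"
        unfolding householder_quad_eq by (intro hom) simp
      then show ?thesis by (simp add: y_def)
    qed simp
  qed
  also have "\<dots> \<le> (\<Sum>i\<in>UNIV. \<integral>\<^sup>+b\<in>cball (axis i 1) \<tau>.
         ennreal (norm (W u - W (householder b (householder (axis i 1) u))) powr q) \<partial>lborel)"
    unfolding e_def by (rule member_le_sum) auto
  finally show ?thesis by (simp add: \<tau>_def mult_left_mono)
qed

lemma annulus_average_le:
  assumes r: "0 < r" and R: "64 * real CARD('n) * r < R" and small: "32 * real CARD('n) * r / R < (1/2) ^ Suc k"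
  shows "(\<integral>\<^sup>+u\<in>{u. R / 2 \<le> norm u \<and> norm u \<le> 3 * R}.
      (\<integral>\<^sup>+v\<in>ball u (2 * r). ennreal (norm (W u - W v) powr q) \<partial>lborel) \<partial>lborel)
    \<le> ennreal (rot_const TYPE(real^'n) * r ^ CARD('n) * R ^ CARD('n) * d k powr q)"
proof -
  define \<tau> where "\<tau> = 4 * real CARD('n) * r / R"
  have "0 < 64 * real CARD('n) * r" using r by simp
  then have R0: "R > 0" using R by linarith
  have \<tau>: "0 < \<tau>" "\<tau> < 1" using R R0 r by (auto simp: \<tau>_def field_simps)
  define c where "c = lip_const TYPE(real^'n) * (36 * R) ^ CARD('n)"
  have c0: "c \<ge> 0" using R0 by (simp add: c_def lip_const_def)
  have ball_m [measurable]: "ball (0::real^'n) t \<in> sets borel" "cball (x::real^'n) t \<in> sets borel" for t x by simp_all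
  define H where "H i b u = ennreal (norm (W u - W (householder b (householder (axis i 1) u))) powr q)" for i b u
  have [measurable]: "(\<lambda>(b, u). H i b u) \<in> borel_measurable (lborel \<Otimes>\<^sub>M lborel)" for i
    unfolding H_def by measurable
  have "(\<integral>\<^sup>+u\<in>{u. R / 2 \<le> norm u \<and> norm u \<le> 3 * R}.
      (\<integral>\<^sup>+v\<in>ball u (2 * r). ennreal (norm (W u - W v) powr q) \<partial>lborel) \<partial>lborel)
    \<le> (\<integral>\<^sup>+u\<in>ball 0 (4 * R). ennreal c * (\<Sum>i\<in>UNIV. \<integral>\<^sup>+b\<in>cball (axis i 1) \<tau>. H i b u \<partial>lborel) \<partial>lborel)"
    using inner_average_le_rotations[OF r R] R0
    by (intro nn_integral_mono) (auto simp: indicator_def c_def \<tau>_def H_def)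
  also have "\<dots> = ennreal c * (\<Sum>i\<in>UNIV. (\<integral>\<^sup>+u. (\<integral>\<^sup>+b. H i b u * indicator (cball (axis i 1) \<tau>) b
     * indicator (ball 0 (4 * R)) u \<partial>lborel) \<partial>lborel))"
  proof -
    have "(\<integral>\<^sup>+u\<in>ball 0 (4 * R). ennreal c * (\<Sum>i\<in>UNIV. \<integral>\<^sup>+b\<in>cball (axis i 1) \<tau>. H i b u \<partial>lborel) \<partial>lborel)
      = ennreal c * (\<integral>\<^sup>+u. (\<Sum>i\<in>UNIV. (\<integral>\<^sup>+b\<in>cball (axis i 1) \<tau>. H i b u \<partial>lborel) * indicator (ball 0 (4 * R)) u) \<partial>lborel)"
      by (simp only: mult.assoc sum_distrib_right) (rule nn_integral_cmult, measurable)
    also have "(\<integral>\<^sup>+u. (\<Sum>i\<in>UNIV. (\<integral>\<^sup>+b\<in>cball (axis i 1) \<tau>. H i b u \<partial>lborel) * indicator (ball 0 (4 * R)) u) \<partial>lborel)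
      = (\<Sum>i\<in>UNIV. \<integral>\<^sup>+u. (\<integral>\<^sup>+b\<in>cball (axis i 1) \<tau>. H i b u \<partial>lborel) * indicator (ball 0 (4 * R)) u \<partial>lborel)"
      by (rule nn_integral_sum) measurable
    also have "\<dots> = (\<Sum>i\<in>UNIV. (\<integral>\<^sup>+u. (\<integral>\<^sup>+b. H i b u * indicator (cball (axis i 1) \<tau>) b
       * indicator (ball 0 (4 * R)) u \<partial>lborel) \<partial>lborel))"
      by (intro sum.cong refl nn_integral_cong nn_integral_multc[symmetric]) measurable
    finally show ?thesis .
  qed
  also have "\<dots> = ennreal c * (\<Sum>i\<in>UNIV. (\<integral>\<^sup>+b. (\<integral>\<^sup>+u. H i b u * indicator (cball (axis i 1) \<tau>) b
     * indicator (ball 0 (4 * R)) u \<partial>lborel) \<partial>lborel))"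
    by (intro arg_cong2[of _ _ _ _ "(*)"] refl sum.cong lborel_pair.Fubini') measurable
  also have "\<dots> \<le> ennreal c * (\<Sum>i\<in>(UNIV::'n set). (\<integral>\<^sup>+b. ennreal ((4 * R) ^ CARD('n) * d k powr q) *
      indicator (cball (axis i 1 :: real^'n) \<tau>) b \<partial>lborel))"
  proof (intro mult_left_mono sum_mono nn_integral_mono)
    fix i :: 'n and b :: "real^'n"
    show "(\<integral>\<^sup>+u. H i b u * indicator (cball (axis i 1) \<tau>) b * indicator (ball 0 (4 * R)) u \<partial>lborel)
      \<le> ennreal ((4 * R) ^ CARD('n) * d k powr q) * indicator (cball (axis i 1 :: real^'n) \<tau>) b"
    proof (cases "b \<in> cball (axis i 1) \<tau>")
      case True
      then have b: "b \<noteq> 0" "norm (b - axis i 1) \<le> \<tau>"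
        using \<tau> by (auto simp: dist_norm norm_minus_commute)
      obtain \<rho> where \<rho>: "rotation_matrix \<rho>" "rot_size \<rho> \<le> 8 * norm (b - axis i 1)"
        "\<And>x. \<rho> *v x = householder b (householder (axis i 1) x)"
        using householder_product_rotation[OF b(1), of "axis i 1"] by auto
      have rot: "rot_size \<rho> < (1/2) ^ Suc k"
        using \<rho>(2) b(2) small by (simp add: \<tau>_def)
      have "H i b (t *\<^sub>R x) = H i b x" if "t > 0" for t x
        using that by (simp add: H_def linear_cmul[OF linear_householder] hom)
      then have "(\<integral>\<^sup>+u\<in>ball 0 (4 * R). H i b u \<partial>lborel) =
        ennreal ((4 * R) ^ DIM(real^'n)) * (\<integral>\<^sup>+u\<in>ball 0 1. H i b u \<partial>lborel)"
        using R0 by (intro nn_integral_ball_homogeneous) auto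
      also have "\<dots> \<le> ennreal ((4 * R) ^ CARD('n)) * ennreal (d k powr q)"
        using modulus[OF \<rho>(1) rot] by (simp add: H_def \<rho>(3) norm_minus_commute mult_left_mono)
      finally show ?thesis using True R0 by (simp add: ennreal_mult)
    qed simp
  qed simp_all
  also have "\<dots> = ennreal c * (\<Sum>i\<in>(UNIV::'n set). ennreal ((4 * R) ^ CARD('n) * d k powr q) * ennreal (unit_ball_vol (real CARD('n)) * \<tau> ^ CARD('n)))"
    using \<tau> by (simp add: nn_integral_cmult emeasure_cball)
  also have "\<dots> = ennreal (c * (real CARD('n) * ((4 * R) ^ CARD('n) * d k powr q * (unit_ball_vol (real CARD('n)) * \<tau> ^ CARD('n)))))"
    using c0 \<tau> R0 by (simp add: ennreal_mult ennreal_of_nat_eq_real_of_nat mult_ac)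
  also have "c * (real CARD('n) * ((4 * R) ^ CARD('n) * d k powr q * (unit_ball_vol (real CARD('n)) * \<tau> ^ CARD('n)))) = rot_const TYPE(real^'n) * r ^ CARD('n) * R ^ CARD('n) * d k powr q"
    using R0 by (simp add: rot_const_def c_def \<tau>_def power_mult_distrib power_divide)
  finally show ?thesis .
qed

end

section \<open>The kernel far from the origin\<close>

lemma powr_add_le_two_powr:
  fixes a b q :: real
  assumes "0 \<le> a" "0 \<le> b" "0 \<le> q"
  shows "(a + b) powr q \<le> 2 powr q * (a powr q + b powr q)"
proof -
  have "(a + b) powr q \<le> (2 * max a b) powr q"
    using assms by (intro powr_mono2) auto
  also have "\<dots> = 2 powr q * max a b powr q"
    using assms by (simp add: powr_mult)
  also have "max a b powr q \<le> a powr q + b powr q"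
    by (simp add: max_def)
  finally show ?thesis by simp
qed

lemma powr_minus_diff_le:
  fixes a b c x y :: real
  assumes c: "0 < c" and a: "0 < a" "a \<le> x" "a \<le> y"
  shows "\<bar>x powr (-c) - y powr (-c)\<bar> \<le> c * a powr (-c - 1) * \<bar>x - y\<bar>"
proof -
  have main: "\<bar>x powr (-c) - y powr (-c)\<bar> \<le> c * a powr (-c - 1) * \<bar>x - y\<bar>"
    if xy: "x < y" "a \<le> x" for x y :: real
  proof -
    have "\<exists>z>x. z < y \<and> y powr (-c) - x powr (-c) = (y - x) * (- c * z powr (-c - 1))"
      using xy a(1) by (intro MVT2) (auto intro!: derivative_eq_intros has_real_derivative_powr')
    then obtain z where z: "x < z" "y powr (-c) - x powr (-c) = (y - x) * (- c * z powr (-c - 1))"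
      by blast
    have "z powr (-c - 1) \<le> a powr (-c - 1)"
      using z(1) xy a(1) c by (intro powr_mono2') auto
    then have "(y - x) * c * z powr (-c - 1) \<le> (y - x) * c * a powr (-c - 1)"
      using xy c by (intro mult_left_mono) auto
    moreover have "0 \<le> (y - x) * c * z powr (-c - 1)" using xy c by simp
    ultimately show ?thesis using z(2) xy by (simp add: abs_if algebra_simps)
  qed
  show ?thesis
    using main[of x y] main[of y x] a
    by (cases x y rule: linorder_cases) (auto simp: abs_minus_commute)
qed

lemma ex_dyadic_annulus:
  fixes t s c :: real
  assumes t: "0 < t" "t < s"
  shows "\<exists>j. s * (1/2) ^ Suc j \<le> t \<and> t < s * (1/2) ^ j"
proof -
  have s: "0 < s" using t by simp
  have ex: "\<exists>j. s * (1/2) ^ Suc j \<le> t"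
  proof -
    obtain m where "(1/2::real) ^ m < t / s"
      using real_arch_pow_inv[of "t / s" "1/2"] t s by auto
    then have "s * (1/2) ^ m < t" using s by (simp add: field_simps)
    moreover have "s * (1/2) ^ Suc m \<le> s * (1/2) ^ m" using s by simp
    ultimately show ?thesis by (intro exI[of _ m]) linarith
  qed
  obtain j where j: "s * (1/2) ^ Suc j \<le> t" "\<forall>i<j. \<not> s * (1/2) ^ Suc i \<le> t"
    using ex exists_least_iff[of "\<lambda>j. s * (1/2) ^ Suc j \<le> t"] by blast
  note j(1)
  moreover have "t < s * (1/2) ^ j"
  proof (cases j)
    case (Suc i)
    then have "\<not> s * (1/2) ^ Suc i \<le> t" using j(2) by blast
    then show ?thesis using Suc by simp
  qed (use t in simp)
  ultimately show ?thesis by blast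
qed

lemma ex_dyadic_annulus_outer:
  fixes t s :: real
  assumes t: "0 < s" "s \<le> t"
  shows "\<exists>j. s * 2 ^ j \<le> t \<and> t < 2 * (s * 2 ^ j)"
proof -
  have ex: "\<exists>j. t < 2 * (s * 2 ^ j)"
  proof -
    obtain m where "t / s < 2 ^ m" using real_arch_pow[of 2 "t / s"] by auto
    then have "t < s * 2 ^ m" using t by (simp add: field_simps)
    then show ?thesis using t by (intro exI[of _ m]) linarith
  qed
  obtain j where j: "t < 2 * (s * 2 ^ j)" "\<forall>i<j. \<not> t < 2 * (s * 2 ^ i)"
    using ex exists_least_iff[of "\<lambda>j. t < 2 * (s * 2 ^ j)"] by blast
  note j(1)
  moreover have "s * 2 ^ j \<le> t"
  proof (cases j)
    case (Suc i)
    then have "\<not> t < 2 * (s * 2 ^ i)" using j(2) by blast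
    then show ?thesis using Suc by simp
  qed (use t in simp)
  ultimately show ?thesis by blast
qed

context dini_kernel
begin

definition K :: "real^'n \<Rightarrow> complex" where
  "K u = W u / of_real (norm u powr (real CARD('n) - \<alpha>))"

lemma K_measurable [measurable]: "K \<in> borel_measurable borel"
  unfolding K_def by measurable

lemma q_pos: "0 < q" using q_gt_1 by simp

lemma exponent_q: "(real CARD('n) - \<alpha>) * q = real CARD('n)"
  using \<alpha> by (simp add: q_def)

lemma norm_K: "norm (K u) = norm (W u) * norm u powr (\<alpha> - real CARD('n))"
  by (simp add: K_def norm_divide powr_minus_divide[of _ "real CARD('n) - \<alpha>", simplified])

lemma kernel_diff_le:
  assumes r: "0 < r" and R: "64 * r < R" and u: "R / 2 \<le> norm u" and v: "norm (v - u) < 2 * r"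
  shows "norm (K u - K v) powr q \<le> 2 powr q * (4 / R) ^ CARD('n) *
    (norm (W u - W v) powr q + (8 * (real CARD('n) - \<alpha>)) powr q * (r / R) powr q * norm (W u) powr q)"
proof -
  define \<beta> where "\<beta> = real CARD('n) - \<alpha>"
  have \<beta>: "0 < \<beta>" "\<beta> * q = real CARD('n)" using \<alpha> exponent_q by (auto simp: \<beta>_def)
  have R0: "R > 0" using r R by linarith
  have v4: "R / 4 \<le> norm v"
    using norm_triangle_ineq2[of u "u - v"] u v R r by (simp add: norm_minus_commute)
  have u4: "R / 4 \<le> norm u" using u R0 by simp
  have pw: "((R / 4) powr (-\<beta>)) powr q = (4 / R) ^ CARD('n)"
  proof -
    have "((R / 4) powr (-\<beta>)) powr q = (R / 4) powr (- real CARD('n))"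
      using \<beta> by (simp add: powr_powr)
    also have "\<dots> = (4 / R) powr (real CARD('n))"
      using R0 by (simp add: powr_minus powr_divide)
    finally show ?thesis using R0 by (simp add: powr_realpow)
  qed
  have K: "K x = W x * of_real (norm x powr (-\<beta>))" for x
    by (simp add: K_def \<beta>_def[symmetric] powr_minus divide_inverse)
  have "K u - K v = (W u - W v) * of_real (norm v powr (-\<beta>)) + W u * of_real (norm u powr (-\<beta>) - norm v powr (-\<beta>))"
    by (simp add: K algebra_simps)
  then have "norm (K u - K v) \<le> norm (W u - W v) * norm v powr (-\<beta>)
      + norm (W u) * \<bar>norm u powr (-\<beta>) - norm v powr (-\<beta>)\<bar>"
    using norm_triangle_ineq[of "(W u - W v) * of_real (norm v powr (-\<beta>))"
      "W u * of_real (norm u powr (-\<beta>) - norm v powr (-\<beta>))"]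
    by (simp add: norm_mult del: of_real_diff)
  also have "\<dots> \<le> norm (W u - W v) * (R / 4) powr (-\<beta>) + norm (W u) * ((R / 4) powr (-\<beta>) * (8 * \<beta> * (r / R)))"
  proof (intro add_mono mult_left_mono)
    show "norm v powr (-\<beta>) \<le> (R / 4) powr (-\<beta>)"
      using v4 R0 \<beta> by (intro powr_mono2') auto
    have "\<bar>norm u powr (-\<beta>) - norm v powr (-\<beta>)\<bar> \<le> \<beta> * (R / 4) powr (-\<beta> - 1) * \<bar>norm u - norm v\<bar>"
      using u4 v4 R0 \<beta> by (intro powr_minus_diff_le) auto
    also have "\<dots> \<le> \<beta> * (R / 4) powr (-\<beta> - 1) * (2 * r)"
      using v \<beta> norm_triangle_ineq3[of u v] by (intro mult_left_mono) (auto simp: norm_minus_commute)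
    also have "(R / 4) powr (-\<beta> - 1) = (R / 4) powr (-\<beta>) * (4 / R)"
      using R0 by (simp add: powr_diff)
    finally show "\<bar>norm u powr (-\<beta>) - norm v powr (-\<beta>)\<bar> \<le> (R / 4) powr (-\<beta>) * (8 * \<beta> * (r / R))"
      using R0 by (simp add: field_simps)
  qed auto
  finally have "norm (K u - K v) powr q \<le> (norm (W u - W v) * (R / 4) powr (-\<beta>) + norm (W u) * ((R / 4) powr (-\<beta>) * (8 * \<beta> * (r / R)))) powr q"
    using q_pos by (intro powr_mono2) auto
  also have "\<dots> \<le> 2 powr q * ((norm (W u - W v) * (R / 4) powr (-\<beta>)) powr q + (norm (W u) * ((R / 4) powr (-\<beta>) * (8 * \<beta> * (r / R)))) powr q)"
    using q_pos r R0 \<beta> by (intro powr_add_le_two_powr) auto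
  also have "(norm (W u - W v) * (R / 4) powr (-\<beta>)) powr q = norm (W u - W v) powr q * (4 / R) ^ CARD('n)"
    by (simp add: powr_mult pw)
  also have "(norm (W u) * ((R / 4) powr (-\<beta>) * (8 * \<beta> * (r / R)))) powr q =
      norm (W u) powr q * ((4 / R) ^ CARD('n) * ((8 * \<beta>) powr q * (r / R) powr q))"
    by (simp only: powr_mult pw mult.assoc)
  finally show ?thesis by (simp add: \<beta>_def algebra_simps)
qed

definition "C_far = 2 powr q * 4 ^ CARD('n) * (rot_const TYPE(real^'n) +
   (8 * (real CARD('n) - \<alpha>)) powr q * (unit_ball_vol (real CARD('n)) * 2 ^ CARD('n) * 4 ^ CARD('n) * M))"

lemma C_far_nonneg: "0 \<le> C_far"
  using M(1) by (simp add: C_far_def rot_const_nonneg)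

lemma kernel_annulus_le:
  assumes r: "0 < r" and R: "R = 128 * real CARD('n) * r * 2 ^ k"
  shows "(\<integral>\<^sup>+u\<in>{u. R / 2 \<le> norm u \<and> norm u \<le> 3 * R}.
      (\<integral>\<^sup>+v\<in>ball u (2 * r). ennreal (norm (K u - K v) powr q) \<partial>lborel) \<partial>lborel)
    \<le> ennreal (C_far * r ^ CARD('n) * d k powr q)"
proof -
  define A where "A = {u::real^'n. R / 2 \<le> norm u \<and> norm u \<le> 3 * R}"
  have [measurable]: "A \<in> sets borel" unfolding A_def by measurable
  have ball_m [measurable]: "ball (x::real^'n) t \<in> sets borel" for t x by simp_all
  have n1: "1 \<le> real CARD('n)" using dim by linarith
  have two: "(1::real) \<le> 2 ^ k" by simp
  have n2: "1 \<le> real CARD('n) * 2 ^ k" using mult_mono[OF n1 two] by simp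
  have R0: "0 < R" using r R by simp
  have R64n: "64 * real CARD('n) * r < R"
  proof -
    have "64 * real CARD('n) * r * 1 \<le> 64 * real CARD('n) * r * 2 ^ k" using r by (intro mult_left_mono) auto
    then show ?thesis using R R0 by (simp add: mult_ac)
  qed
  have R64: "64 * r < R"
  proof -
    have "64 * r * 1 \<le> 64 * r * real CARD('n)" using n1 r by (intro mult_left_mono) auto
    then show ?thesis using R64n by (simp add: mult_ac)
  qed
  have small: "32 * real CARD('n) * r / R < (1/2) ^ Suc k"
    using r by (simp add: R power_divide) (simp add: field_simps)
  have rRd: "r / R \<le> d k"
  proof -
    have "r / R = 1 / (128 * real CARD('n)) * (1/2) ^ k" using r by (simp add: R power_divide)
    also have "\<dots> \<le> 1 * (1/2) ^ k"
    proof (rule mult_right_mono)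
      have "1 \<le> 128 * real CARD('n)" using n1 by linarith
      then show "1 / (128 * real CARD('n)) \<le> 1" by simp
    qed simp
    finally show ?thesis using d(1)[of k] by simp
  qed
  define c where "c = 2 powr q * (4 / R) ^ CARD('n)"
  define b where "b = (8 * (real CARD('n) - \<alpha>)) powr q * (r / R) powr q"
  have cb: "0 \<le> c" "0 \<le> b" using R0 by (auto simp: c_def b_def)
  have "(\<integral>\<^sup>+u\<in>A. (\<integral>\<^sup>+v\<in>ball u (2 * r). ennreal (norm (K u - K v) powr q) \<partial>lborel) \<partial>lborel)
    \<le> (\<integral>\<^sup>+u. ennreal c * ((\<integral>\<^sup>+v\<in>ball u (2 * r). ennreal (norm (W u - W v) powr q) \<partial>lborel) * indicator A u)
        + ennreal (c * b * (unit_ball_vol (real CARD('n)) * (2 * r) ^ CARD('n))) * (ennreal (norm (W u) powr q) * indicator (ball 0 (4 * R)) u) \<partial>lborel)"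
  proof (intro nn_integral_mono)
    fix u :: "real^'n"
    show "(\<integral>\<^sup>+v\<in>ball u (2 * r). ennreal (norm (K u - K v) powr q) \<partial>lborel) * indicator A u
      \<le> ennreal c * ((\<integral>\<^sup>+v\<in>ball u (2 * r). ennreal (norm (W u - W v) powr q) \<partial>lborel) * indicator A u)
        + ennreal (c * b * (unit_ball_vol (real CARD('n)) * (2 * r) ^ CARD('n))) * (ennreal (norm (W u) powr q) * indicator (ball 0 (4 * R)) u)"
    proof (cases "u \<in> A")
      case True
      have "(\<integral>\<^sup>+v\<in>ball u (2 * r). ennreal (norm (K u - K v) powr q) \<partial>lborel)
        \<le> (\<integral>\<^sup>+v. ennreal c * (ennreal (norm (W u - W v) powr q) * indicator (ball u (2 * r)) v)
          + ennreal (c * b * norm (W u) powr q) * indicator (ball u (2 * r)) v \<partial>lborel)"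
      proof (intro nn_integral_mono)
        fix v
        show "ennreal (norm (K u - K v) powr q) * indicator (ball u (2 * r)) v \<le>
          ennreal c * (ennreal (norm (W u - W v) powr q) * indicator (ball u (2 * r)) v)
          + ennreal (c * b * norm (W u) powr q) * indicator (ball u (2 * r)) v"
        proof (cases "v \<in> ball u (2 * r)")
          case v: True
          have "norm (K u - K v) powr q \<le> c * norm (W u - W v) powr q + c * b * norm (W u) powr q"
            using kernel_diff_le[OF r R64, of u v] True v
            by (simp add: A_def dist_norm norm_minus_commute c_def b_def algebra_simps)
          then show ?thesis using v cb
            by (simp add: ennreal_mult[symmetric] flip: ennreal_plus)
        qed simp
      qed
      also have "\<dots> = ennreal c * (\<integral>\<^sup>+v\<in>ball u (2 * r). ennreal (norm (W u - W v) powr q) \<partial>lborel)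
          + ennreal (c * b * norm (W u) powr q) * emeasure lborel (ball u (2 * r))"
        by (simp add: nn_integral_add nn_integral_cmult)
      also have "emeasure lborel (ball u (2 * r)) = ennreal (unit_ball_vol (real CARD('n)) * (2 * r) ^ CARD('n))"
        using r by (simp add: emeasure_ball)
      finally show ?thesis using True R0 cb r
        by (simp add: A_def ennreal_mult[symmetric] mult_ac)
    qed simp
  qed
  also have "\<dots> = ennreal c * (\<integral>\<^sup>+u\<in>A. (\<integral>\<^sup>+v\<in>ball u (2 * r). ennreal (norm (W u - W v) powr q) \<partial>lborel) \<partial>lborel)
    + ennreal (c * b * (unit_ball_vol (real CARD('n)) * (2 * r) ^ CARD('n))) * (\<integral>\<^sup>+u\<in>ball 0 (4 * R). ennreal (norm (W u) powr q) \<partial>lborel)"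
  proof -
    have [measurable]: "(\<lambda>u. \<integral>\<^sup>+v\<in>ball u (2 * r). ennreal (norm (W u - W v) powr q) \<partial>lborel) \<in> borel_measurable lborel"
    proof -
      have "(\<lambda>u. \<integral>\<^sup>+v. ennreal (norm (W u - W v) powr q) * indicator {z. dist (fst z) (snd z) < 2 * r} (u, v) \<partial>lborel) \<in> borel_measurable lborel"
        by measurable
      then show ?thesis by (simp add: indicator_def)
    qed
    show ?thesis by (subst nn_integral_add, measurable) (simp add: nn_integral_cmult)
  qed
  also have "\<dots> \<le> ennreal c * ennreal (rot_const TYPE(real^'n) * r ^ CARD('n) * R ^ CARD('n) * d k powr q)
    + ennreal (c * b * (unit_ball_vol (real CARD('n)) * (2 * r) ^ CARD('n))) * (ennreal ((4 * R) ^ CARD('n)) * ennreal M)"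
  proof (intro add_mono mult_left_mono)
    show "(\<integral>\<^sup>+u\<in>A. (\<integral>\<^sup>+v\<in>ball u (2 * r). ennreal (norm (W u - W v) powr q) \<partial>lborel) \<partial>lborel)
      \<le> ennreal (rot_const TYPE(real^'n) * r ^ CARD('n) * R ^ CARD('n) * d k powr q)"
      unfolding A_def by (rule annulus_average_le[OF r R64n small])
    have "(\<integral>\<^sup>+u\<in>ball 0 (4 * R). ennreal (norm (W u) powr q) \<partial>lborel)
      = ennreal ((4 * R) ^ DIM(real^'n)) * (\<integral>\<^sup>+u\<in>ball 0 1. ennreal (norm (W u) powr q) \<partial>lborel)"
      using R0 by (intro nn_integral_ball_homogeneous) (auto simp: hom)
    also have "\<dots> \<le> ennreal ((4 * R) ^ DIM(real^'n)) * ennreal M"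
      by (intro mult_left_mono M) simp
    finally show "(\<integral>\<^sup>+u\<in>ball 0 (4 * R). ennreal (norm (W u) powr q) \<partial>lborel) \<le> ennreal ((4 * R) ^ CARD('n)) * ennreal M"
      by simp
  qed simp_all
  also have "\<dots> = ennreal (c * (rot_const TYPE(real^'n) * r ^ CARD('n) * R ^ CARD('n) * d k powr q)
    + c * b * (unit_ball_vol (real CARD('n)) * (2 * r) ^ CARD('n)) * ((4 * R) ^ CARD('n) * M))"
    using cb r R0 M(1) by (simp add: ennreal_mult'[symmetric] rot_const_nonneg flip: ennreal_plus)
  also have "\<dots> \<le> ennreal (C_far * r ^ CARD('n) * d k powr q)"
  proof (rule ennreal_leI)
    have cR: "c * R ^ CARD('n) = 2 powr q * 4 ^ CARD('n)" using R0 by (simp add: c_def power_divide)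
    have bd: "b \<le> (8 * (real CARD('n) - \<alpha>)) powr q * d k powr q"
      unfolding b_def using rRd r R0 q_pos by (intro mult_left_mono powr_mono2) auto
    have "c * (rot_const TYPE(real^'n) * r ^ CARD('n) * R ^ CARD('n) * d k powr q)
      + c * b * (unit_ball_vol (real CARD('n)) * (2 * r) ^ CARD('n)) * ((4 * R) ^ CARD('n) * M)
      = (c * R ^ CARD('n)) * r ^ CARD('n) * (rot_const TYPE(real^'n) * d k powr q
        + b * (unit_ball_vol (real CARD('n)) * 2 ^ CARD('n) * 4 ^ CARD('n) * M))"
      by (simp add: power_mult_distrib algebra_simps)
    also have "\<dots> \<le> (c * R ^ CARD('n)) * r ^ CARD('n) * (rot_const TYPE(real^'n) * d k powr q
        + (8 * (real CARD('n) - \<alpha>)) powr q * d k powr q * (unit_ball_vol (real CARD('n)) * 2 ^ CARD('n) * 4 ^ CARD('n) * M))"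
      using bd cb R0 r M(1) by (intro mult_left_mono add_left_mono mult_right_mono) auto
    also have "\<dots> = C_far * r ^ CARD('n) * d k powr q"
      unfolding cR C_far_def by (simp add: algebra_simps)
    finally show "c * (rot_const TYPE(real^'n) * r ^ CARD('n) * R ^ CARD('n) * d k powr q)
      + c * b * (unit_ball_vol (real CARD('n)) * (2 * r) ^ CARD('n)) * ((4 * R) ^ CARD('n) * M)
      \<le> C_far * r ^ CARD('n) * d k powr q" .
  qed
  finally show ?thesis by (simp add: A_def)
qed

end

lemma Youngs_inequality_scaled:
  fixes p q :: real
  assumes "1 < p" "1 < q" "1 / p + 1 / q = 1" "0 \<le> a" "0 \<le> b" "0 < D" "0 < A"
  shows "a * b \<le> D * A * ((a / D) powr q + (b / A) powr p)"
proof -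
  have "(a / D) * (b / A) \<le> (a / D) powr q / q + (b / A) powr p / p"
    using assms by (intro Youngs_inequality) (auto simp: add.commute)
  also have "\<dots> \<le> (a / D) powr q + (b / A) powr p"
    using assms by (intro add_mono) (auto simp: divide_le_eq mult_le_cancel_left1)
  finally have "D * A * ((a / D) * (b / A)) \<le> D * A * ((a / D) powr q + (b / A) powr p)"
    using assms by (intro mult_left_mono) auto
  then show ?thesis using assms by simp
qed

lemma ennreal_le_suminf: "f k \<le> (\<Sum>k. f k)" for f :: "nat \<Rightarrow> ennreal"
  using sum_le_suminf[of f "{k}"] by simp

lemma power_powr_commute: "0 \<le> x \<Longrightarrow> (x ^ j) powr a = (x powr a) ^ j" for x a :: real
  by (induction j) (simp_all add: powr_mult)

context dini_kernel
begin

definition "C_near = 2 powr (real CARD('n) - \<alpha>) * (unit_ball_vol (real CARD('n)) + M) * (1 / (1 - (1/2) powr \<alpha>))"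

lemma half_powr_less_1: "(1/2::real) powr \<alpha> < 1"
  using powr_less_mono2[of \<alpha> "1/2" 1] \<alpha> by simp

lemma C_near_nonneg: "0 \<le> C_near"
  using half_powr_less_1 M(1) by (simp add: C_near_def)

lemma nn_integral_W_le: "(\<integral>\<^sup>+u\<in>ball 0 1. ennreal (norm (W u)) \<partial>lborel) \<le> ennreal (unit_ball_vol (real CARD('n)) + M)"
proof -
  have [measurable]: "ball (0::real^'n) 1 \<in> sets borel" by simp
  have "(\<integral>\<^sup>+u\<in>ball 0 1. ennreal (norm (W u)) \<partial>lborel) \<le>
    (\<integral>\<^sup>+u. indicator (ball 0 1) u + ennreal (norm (W u) powr q) * indicator (ball 0 1) u \<partial>lborel)"
  proof (intro nn_integral_mono)
    fix u
    have "norm (W u) \<le> 1 + norm (W u) powr q"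
      using powr_mono[of 1 q "norm (W u)"] q_gt_1 by (cases "norm (W u) \<le> 1") (auto intro: add_increasing2)
    then have "ennreal (norm (W u)) \<le> 1 + ennreal (norm (W u) powr q)"
      by (metis ennreal_1 ennreal_leI ennreal_plus powr_ge_zero zero_le_one)
    then show "ennreal (norm (W u)) * indicator (ball 0 1) u \<le>
      indicator (ball 0 1) u + ennreal (norm (W u) powr q) * indicator (ball 0 1) u"
      by (simp split: split_indicator)
  qed
  also have "\<dots> = ennreal (unit_ball_vol (real CARD('n))) + (\<integral>\<^sup>+u\<in>ball 0 1. ennreal (norm (W u) powr q) \<partial>lborel)"
    by (subst nn_integral_add) (auto simp: emeasure_ball)
  also have "\<dots> \<le> ennreal (unit_ball_vol (real CARD('n))) + ennreal M"
    by (intro add_left_mono M)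
  finally show ?thesis using M(1) by simp
qed

lemma nn_integral_K_ball_le:
  assumes \<rho>: "0 < \<rho>"
  shows "(\<integral>\<^sup>+u\<in>ball 0 \<rho>. ennreal (norm (K u)) \<partial>lborel) \<le> ennreal (C_near * \<rho> powr \<alpha>)"
proof -
  define m where "m = unit_ball_vol (real CARD('n)) + M"
  have m: "m \<ge> 0" using M(1) by (simp add: m_def)
  have [measurable]: "ball (0::real^'n) t \<in> sets borel" for t by simp
  define c where "c j = (\<rho> * (1/2) ^ Suc j) powr (\<alpha> - real CARD('n))" for j
  have "(\<integral>\<^sup>+u\<in>ball 0 \<rho>. ennreal (norm (K u)) \<partial>lborel) \<le>
    (\<integral>\<^sup>+u. (\<Sum>j. ennreal (c j) * (ennreal (norm (W u)) * indicator (ball 0 (\<rho> * (1/2) ^ j)) u)) \<partial>lborel)"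
  proof (intro nn_integral_mono)
    fix u :: "real^'n"
    show "ennreal (norm (K u)) * indicator (ball 0 \<rho>) u \<le>
       (\<Sum>j. ennreal (c j) * (ennreal (norm (W u)) * indicator (ball 0 (\<rho> * (1/2) ^ j)) u))"
    proof (cases "u \<noteq> 0 \<and> norm u < \<rho>")
      case True
      then obtain j where j: "\<rho> * (1/2) ^ Suc j \<le> norm u" "norm u < \<rho> * (1/2) ^ j"
        using ex_dyadic_annulus[of "norm u" \<rho>] by auto
      have "norm u powr (\<alpha> - real CARD('n)) \<le> c j"
        unfolding c_def using j(1) \<rho> \<alpha> by (intro powr_mono2') auto
      then have "norm (K u) \<le> c j * norm (W u)"
        unfolding norm_K by (subst mult.commute) (intro mult_right_mono, auto)
      then have "ennreal (norm (K u)) * indicator (ball 0 \<rho>) u \<le> ennreal (c j) * (ennreal (norm (W u)) * indicator (ball 0 (\<rho> * (1/2) ^ j)) u)"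
        using True j(2) by (simp add: c_def ennreal_mult[symmetric] ennreal_leI)
      also have "\<dots> \<le> (\<Sum>j. ennreal (c j) * (ennreal (norm (W u)) * indicator (ball 0 (\<rho> * (1/2) ^ j)) u))"
        by (rule ennreal_le_suminf)
      finally show ?thesis .
    next
      case False
      then show ?thesis by (auto simp: norm_K)
    qed
  qed
  also have "\<dots> = (\<Sum>j. ennreal (c j) * (\<integral>\<^sup>+u\<in>ball 0 (\<rho> * (1/2) ^ j). ennreal (norm (W u)) \<partial>lborel))"
    by (subst nn_integral_suminf) (auto simp: nn_integral_cmult)
  also have "\<dots> \<le> (\<Sum>j. ennreal (2 powr (real CARD('n) - \<alpha>) * m * \<rho> powr \<alpha> * ((1/2) powr \<alpha>) ^ j))"
  proof (intro suminf_le summableI)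
    fix j
    define t where "t = \<rho> * (1/2) ^ j"
    have t: "t > 0" using \<rho> by (simp add: t_def)
    have "(\<integral>\<^sup>+u\<in>ball 0 t. ennreal (norm (W u)) \<partial>lborel)
      = ennreal (t ^ DIM(real^'n)) * (\<integral>\<^sup>+u\<in>ball 0 1. ennreal (norm (W u)) \<partial>lborel)"
      using t by (intro nn_integral_ball_homogeneous) (auto simp: hom)
    also have "\<dots> \<le> ennreal (t ^ DIM(real^'n)) * ennreal m"
      unfolding m_def by (intro mult_left_mono nn_integral_W_le) simp
    finally have "ennreal (c j) * (\<integral>\<^sup>+u\<in>ball 0 t. ennreal (norm (W u)) \<partial>lborel) \<le> ennreal (c j) * (ennreal (t ^ CARD('n)) * ennreal m)"
      by (intro mult_left_mono) auto
    also have "\<dots> = ennreal (c j * t ^ CARD('n) * m)"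
      using t m by (simp add: c_def ennreal_mult[symmetric] mult_ac)
    also have "c j * t ^ CARD('n) = 2 powr (real CARD('n) - \<alpha>) * t powr \<alpha>"
    proof -
      have "c j = (t / 2) powr (\<alpha> - real CARD('n))" by (simp add: c_def t_def)
      also have "\<dots> = t powr (\<alpha> - real CARD('n)) * 2 powr (real CARD('n) - \<alpha>)"
        using t by (simp add: powr_divide powr_minus_divide[of 2 "real CARD('n) - \<alpha>", simplified])
      also have "\<dots> * t ^ CARD('n) = 2 powr (real CARD('n) - \<alpha>) * (t powr (\<alpha> - real CARD('n)) * t powr real CARD('n))"
        using t by (simp add: powr_realpow)
      finally show ?thesis by (simp flip: powr_add)
    qed
    also have "t powr \<alpha> = \<rho> powr \<alpha> * ((1/2) powr \<alpha>) ^ j"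
      using \<rho> by (simp only: t_def powr_mult) (simp add: power_powr_commute flip: power_one_over)
    finally show "ennreal (c j) * (\<integral>\<^sup>+u\<in>ball 0 (\<rho> * (1/2) ^ j). ennreal (norm (W u)) \<partial>lborel) \<le>
       ennreal (2 powr (real CARD('n) - \<alpha>) * m * \<rho> powr \<alpha> * ((1/2) powr \<alpha>) ^ j)"
      by (simp add: t_def mult_ac)
  qed
  also have "\<dots> = ennreal (2 powr (real CARD('n) - \<alpha>) * m * \<rho> powr \<alpha> * (1 / (1 - (1/2) powr \<alpha>)))"
    using half_powr_less_1 m by (intro suminf_ennreal_eq sums_mult geometric_sums) auto
  finally show ?thesis by (simp add: C_near_def m_def mult_ac)
qed

lemma far_power_le:
  assumes r: "0 < r" and R: "R = 128 * real CARD('n) * r * 2 ^ k"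
  shows "(\<integral>\<^sup>+x\<in>ball a r. (\<integral>\<^sup>+x'\<in>ball a r. (\<integral>\<^sup>+y\<in>{y. R \<le> dist a y \<and> dist a y < 2 * R}.
       ennreal (norm (K (x - y) - K (x' - y)) powr q) \<partial>lborel) \<partial>lborel) \<partial>lborel)
    \<le> ennreal (unit_ball_vol (real CARD('n)) * C_far * (r ^ CARD('n) * r ^ CARD('n)) * d k powr q)"
proof -
  define A where "A = {y. R \<le> dist a y \<and> dist a y < 2 * R}"
  define N where "N = {u::real^'n. R / 2 \<le> norm u \<and> norm u \<le> 3 * R}"
  have [measurable]: "A \<in> sets borel" "N \<in> sets borel" unfolding A_def N_def by measurable
  have ball_m [measurable]: "ball (x::real^'n) t \<in> sets borel" for t x by simp_all
  have n1: "1 \<le> real CARD('n)" using dim by linarith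
  have "1 * 1 \<le> real CARD('n) * 2 ^ k" using n1 by (intro mult_mono) auto
  then have "r * 1 \<le> r * (real CARD('n) * 2 ^ k)" using r by (intro mult_left_mono) auto
  then have Rr: "128 * r \<le> R" by (simp add: R mult_ac)
  define \<Theta> where "\<Theta> u = (\<integral>\<^sup>+v\<in>ball u (2 * r). ennreal (norm (K u - K v) powr q) \<partial>lborel)" for u
  have [measurable]: "\<Theta> \<in> borel_measurable borel"
  proof -
    have "(\<lambda>u. \<integral>\<^sup>+v. ennreal (norm (K u - K v) powr q) * indicator {z. dist (fst z) (snd z) < 2 * r} (u, v) \<partial>lborel) \<in> borel_measurable borel"
      by measurable
    then show ?thesis by (simp add: indicator_def \<Theta>_def[abs_def])
  qed
  have inner: "(\<integral>\<^sup>+x'\<in>ball a r. (\<integral>\<^sup>+y\<in>A. ennreal (norm (K (x - y) - K (x' - y)) powr q) \<partial>lborel) \<partial>lborel)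
      \<le> (\<integral>\<^sup>+u\<in>N. \<Theta> u \<partial>lborel)" if x: "x \<in> ball a r" for x
  proof -
    have "(\<integral>\<^sup>+x'\<in>ball a r. (\<integral>\<^sup>+y\<in>A. ennreal (norm (K (x - y) - K (x' - y)) powr q) \<partial>lborel) \<partial>lborel)
      = (\<integral>\<^sup>+x'. (\<integral>\<^sup>+y. ennreal (norm (K (x - y) - K (x' - y)) powr q) * indicator A y * indicator (ball a r) x' \<partial>lborel) \<partial>lborel)"
      by (intro nn_integral_cong nn_integral_multc[symmetric]) measurable
    also have "\<dots> = (\<integral>\<^sup>+y. (\<integral>\<^sup>+x'. ennreal (norm (K (x - y) - K (x' - y)) powr q) * indicator A y * indicator (ball a r) x' \<partial>lborel) \<partial>lborel)"
      by (rule lborel_pair.Fubini') measurable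
    also have "\<dots> \<le> (\<integral>\<^sup>+y. \<Theta> (x - y) * indicator N (x - y) \<partial>lborel)"
    proof (intro nn_integral_mono)
      fix y
      show "(\<integral>\<^sup>+x'. ennreal (norm (K (x - y) - K (x' - y)) powr q) * indicator A y * indicator (ball a r) x' \<partial>lborel)
        \<le> \<Theta> (x - y) * indicator N (x - y)"
      proof (cases "y \<in> A")
        case True
        have "x - y \<in> N"
          using True x Rr r dist_triangle[of a y x] dist_triangle2[of x y a]
          by (auto simp: A_def N_def dist_norm norm_minus_commute)
        have "(\<integral>\<^sup>+x'. ennreal (norm (K (x - y) - K (x' - y)) powr q) * indicator A y * indicator (ball a r) x' \<partial>lborel)
          \<le> (\<integral>\<^sup>+x'. ennreal (norm (K (x - y) - K (x' - y)) powr q) * indicator (ball (x - y) (2 * r)) (x' - y) \<partial>lborel)"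
        proof (intro nn_integral_mono)
          fix x'
          have "x' - y \<in> ball (x - y) (2 * r)" if "x' \<in> ball a r"
            using that x dist_triangle[of x x' a] by (simp add: dist_norm norm_minus_commute)
          then show "ennreal (norm (K (x - y) - K (x' - y)) powr q) * indicator A y * indicator (ball a r) x'
            \<le> ennreal (norm (K (x - y) - K (x' - y)) powr q) * indicator (ball (x - y) (2 * r)) (x' - y)"
            by (auto simp: indicator_def)
        qed
        also have "\<dots> = \<Theta> (x - y)"
          unfolding \<Theta>_def
          by (rule nn_integral_lborel_translate[of "\<lambda>v. ennreal (norm (K (x - y) - K v) powr q) * indicator (ball (x - y) (2 * r)) v"]) measurable
        finally show ?thesis using \<open>x - y \<in> N\<close> by simp
      qed simp
    qed
    also have "\<dots> = (\<integral>\<^sup>+u\<in>N. \<Theta> u \<partial>lborel)"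
      by (rule nn_integral_lborel_reflect) measurable
    finally show ?thesis .
  qed
  have "(\<integral>\<^sup>+x\<in>ball a r. (\<integral>\<^sup>+x'\<in>ball a r. (\<integral>\<^sup>+y\<in>A.
       ennreal (norm (K (x - y) - K (x' - y)) powr q) \<partial>lborel) \<partial>lborel) \<partial>lborel)
    \<le> (\<integral>\<^sup>+x\<in>ball a r. ennreal (C_far * r ^ CARD('n) * d k powr q) \<partial>lborel)"
  proof (intro nn_integral_mono)
    fix x :: "real^'n"
    show "(\<integral>\<^sup>+x'\<in>ball a r. (\<integral>\<^sup>+y\<in>A. ennreal (norm (K (x - y) - K (x' - y)) powr q) \<partial>lborel) \<partial>lborel) * indicator (ball a r) x
      \<le> ennreal (C_far * r ^ CARD('n) * d k powr q) * indicator (ball a r) x"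
      using order_trans[OF inner kernel_annulus_le[OF r R, folded \<Theta>_def N_def]]
      by (auto simp: indicator_def)
  qed
  also have "\<dots> = ennreal (C_far * r ^ CARD('n) * d k powr q) * ennreal (unit_ball_vol (real CARD('n)) * r ^ CARD('n))"
    using r by (simp add: nn_integral_cmult emeasure_ball)
  also have "\<dots> = ennreal (unit_ball_vol (real CARD('n)) * C_far * (r ^ CARD('n) * r ^ CARD('n)) * d k powr q)"
    using r C_far_nonneg by (simp add: ennreal_mult[symmetric] mult_ac)
  finally show ?thesis by (simp add: A_def)
qed

end

section \<open>Oscillation of the operator\<close>

context dini_kernel
begin

definition T :: "(real^'n \<Rightarrow> complex) \<Rightarrow> real^'n \<Rightarrow> complex" where
  "T f x = (\<integral>y. K (x - y) * f y \<partial>lborel)"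

definition near :: "(real^'n \<Rightarrow> complex) \<Rightarrow> (real^'n) set \<Rightarrow> real^'n \<Rightarrow> ennreal" where
  "near f S x = (\<integral>\<^sup>+y\<in>S. ennreal (norm (K (x - y)) * norm (f y)) \<partial>lborel)"

definition far :: "(real^'n \<Rightarrow> complex) \<Rightarrow> (real^'n) set \<Rightarrow> real^'n \<Rightarrow> real^'n \<Rightarrow> ennreal" where
  "far f S x x' = (\<integral>\<^sup>+y\<in>S. ennreal (norm (K (x - y) - K (x' - y)) * norm (f y)) \<partial>lborel)"

lemma T_measurable [measurable]:
  assumes [measurable]: "f \<in> borel_measurable borel"
  shows "T f \<in> borel_measurable borel"
  unfolding T_def[abs_def] by measurable

lemma near_measurable [measurable]:
  assumes [measurable]: "f \<in> borel_measurable borel" "S \<in> sets borel"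
  shows "near f S \<in> borel_measurable borel"
  unfolding near_def[abs_def] by measurable

lemma far_measurable [measurable]:
  assumes [measurable]: "f \<in> borel_measurable borel" "S \<in> sets borel"
  shows "(\<lambda>(x, x'). far f S x x') \<in> borel_measurable (borel \<Otimes>\<^sub>M borel)"
  unfolding far_def[abs_def] by measurable

text \<open>
  If exactly one of the two integrals defining \<open>T f x\<close> and \<open>T f x'\<close> diverges, the right-hand side
  is infinite; if both diverge, the left-hand side is \<open>0\<close>.
\<close>

lemma norm_T_diff_le:
  assumes [measurable]: "f \<in> borel_measurable borel" "S \<in> sets borel"
  shows "ennreal (norm (T f x - T f x')) \<le> near f S x + near f S x' + far f (- S) x x'"
proof -
  define g where "g x y = K (x - y) * f y" for x y
  have [measurable]: "g x \<in> borel_measurable lborel" for x unfolding g_def[abs_def] by measurable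
  let ?G = "near f S x + near f S x' + far f (- S) x x'"
  have "(\<integral>\<^sup>+y. ennreal (norm (g x y - g x' y)) \<partial>lborel) \<le>
    (\<integral>\<^sup>+y. ennreal (norm (K (x - y)) * norm (f y)) * indicator S y + ennreal (norm (K (x' - y)) * norm (f y)) * indicator S y
      + ennreal (norm (K (x - y) - K (x' - y)) * norm (f y)) * indicator (- S) y \<partial>lborel)"
  proof (intro nn_integral_mono)
    fix y
    have "norm (g x y - g x' y) \<le> norm (K (x - y)) * norm (f y) + norm (K (x' - y)) * norm (f y)"
      unfolding g_def norm_mult[symmetric] by (rule norm_triangle_ineq4)
    moreover have "norm (g x y - g x' y) = norm (K (x - y) - K (x' - y)) * norm (f y)"
      by (simp add: g_def norm_mult flip: left_diff_distrib)
    ultimately show "ennreal (norm (g x y - g x' y)) \<le>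
      ennreal (norm (K (x - y)) * norm (f y)) * indicator S y + ennreal (norm (K (x' - y)) * norm (f y)) * indicator S y
      + ennreal (norm (K (x - y) - K (x' - y)) * norm (f y)) * indicator (- S) y"
      by (auto simp: indicator_def ennreal_leI simp flip: ennreal_plus)
  qed
  also have "\<dots> = ?G"
    unfolding near_def far_def by (simp add: nn_integral_add)
  finally have le: "(\<integral>\<^sup>+y. ennreal (norm (g x y - g x' y)) \<partial>lborel) \<le> ?G" .
  show ?thesis
  proof (cases "?G = \<infinity>")
    case False
    then have "?G < \<infinity>" by (simp only: infinity_ennreal_def less_top)
    then have int: "integrable lborel (\<lambda>y. g x y - g x' y)"
      using le_less_trans[OF le] by (intro integrableI_bounded) simp_all
    show ?thesis
    proof (cases "integrable lborel (g x)")
      case True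
      then have "integrable lborel (g x')"
      proof -
        have "integrable lborel (\<lambda>y. g x y - (g x y - g x' y))"
          by (rule Bochner_Integration.integrable_diff[OF True int])
        then show ?thesis by (simp only: diff_diff_eq2 add_diff_cancel_left')
      qed
      then have "T f x - T f x' = (\<integral>y. g x y - g x' y \<partial>lborel)"
        using True by (simp add: T_def g_def[symmetric])
      then show ?thesis using order_trans[OF integral_norm_bound_ennreal[OF int] le] by simp
    next
      case f: False
      then have "\<not> integrable lborel (g x')"
      proof (rule contrapos_nn)
        assume "integrable lborel (g x')"
        then have "integrable lborel (\<lambda>y. (g x y - g x' y) + g x' y)"
          by (rule Bochner_Integration.integrable_add[OF int])
        then show "integrable lborel (g x)" by (simp only: diff_add_cancel)
      qed
      then have "T f x = 0" "T f x' = 0"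
        using f by (simp_all add: T_def g_def[symmetric] not_integrable_integral_eq)
      then show ?thesis by simp
    qed
  next
    case True
    then show ?thesis by (simp only: infinity_ennreal_def top_greatest)
  qed
qed

lemma conjugate_exponents:
  assumes "p = real CARD('n) / \<alpha>"
  shows "1 < p" "1 / p + 1 / q = 1"
proof -
  show "1 < p" using \<alpha> by (simp add: assms)
  have "1 / p + 1 / q = (\<alpha> + (real CARD('n) - \<alpha>)) / real CARD('n)"
    by (simp add: assms q_def add_divide_distrib diff_divide_distrib)
  then show "1 / p + 1 / q = 1" by simp
qed

definition "C_osc_near = ((128 * real CARD('n)) ^ CARD('n) * unit_ball_vol (real CARD('n)) + 1) *
  (C_near * (128 * real CARD('n) + 1) powr \<alpha>)"

lemma near_integral_le:
  assumes f[measurable]: "f \<in> borel_measurable borel" and p: "p = real CARD('n) / \<alpha>"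
    and A: "0 < A" "(\<integral>\<^sup>+y. ennreal (norm (f y) powr p) \<partial>lborel) \<le> ennreal (A powr p)"
    and r: "0 < r"
  shows "(\<integral>\<^sup>+x\<in>ball a r. near f (ball a (128 * real CARD('n) * r)) x \<partial>lborel) \<le> ennreal (C_osc_near * A * r ^ CARD('n))"
proof -
  define R where "R = 128 * real CARD('n) * r"
  have R: "R > 0" using r by (simp add: R_def)
  have [measurable]: "ball (b::real^'n) t \<in> sets borel" for b t by simp
  define \<beta> where "\<beta> = real CARD('n) - \<alpha>"
  have \<beta>: "\<beta> > 0" "\<beta> * q = real CARD('n)" "\<beta> + \<alpha> = real CARD('n)" using \<alpha> exponent_q by (auto simp: \<beta>_def)
  note pq = conjugate_exponents[OF p]
  have "(\<integral>\<^sup>+y\<in>ball a R. ennreal (norm (f y)) \<partial>lborel) \<le>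
    (\<integral>\<^sup>+y. ennreal (r powr \<beta> * A * ((1 / r powr \<beta>) powr q)) * indicator (ball a R) y
       + ennreal (r powr \<beta> * A / A powr p) * ennreal (norm (f y) powr p) \<partial>lborel)"
  proof (intro nn_integral_mono)
    fix y
    have "1 * norm (f y) \<le> r powr \<beta> * A * ((1 / r powr \<beta>) powr q + (norm (f y) / A) powr p)"
      using pq q_gt_1 A r by (intro Youngs_inequality_scaled) auto
    also have "\<dots> = r powr \<beta> * A * ((1 / r powr \<beta>) powr q) + r powr \<beta> * A / A powr p * norm (f y) powr p"
      using A by (simp add: powr_divide algebra_simps)
    finally show "ennreal (norm (f y)) * indicator (ball a R) y \<le>
      ennreal (r powr \<beta> * A * ((1 / r powr \<beta>) powr q)) * indicator (ball a R) y
       + ennreal (r powr \<beta> * A / A powr p) * ennreal (norm (f y) powr p)"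
      using A by (auto simp: indicator_def ennreal_mult[symmetric] simp flip: ennreal_plus)
  qed
  also have "\<dots> = ennreal (r powr \<beta> * A * ((1 / r powr \<beta>) powr q)) * ennreal (unit_ball_vol (real CARD('n)) * R ^ CARD('n))
       + ennreal (r powr \<beta> * A / A powr p) * (\<integral>\<^sup>+y. ennreal (norm (f y) powr p) \<partial>lborel)"
    using R by (simp add: nn_integral_add nn_integral_cmult emeasure_ball)
  also have "\<dots> \<le> ennreal (r powr \<beta> * A * ((1 / r powr \<beta>) powr q)) * ennreal (unit_ball_vol (real CARD('n)) * R ^ CARD('n))
       + ennreal (r powr \<beta> * A / A powr p) * ennreal (A powr p)"
    by (intro add_left_mono mult_left_mono A) simp
  also have "\<dots> = ennreal (r powr \<beta> * A * ((1 / r powr \<beta>) powr q * (unit_ball_vol (real CARD('n)) * R ^ CARD('n)) + 1))"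
    using A R r by (simp add: ennreal_mult[symmetric] algebra_simps flip: ennreal_plus)
  also have "(1 / r powr \<beta>) powr q * (unit_ball_vol (real CARD('n)) * R ^ CARD('n)) + 1 =
     (128 * real CARD('n)) ^ CARD('n) * unit_ball_vol (real CARD('n)) + 1"
  proof -
    have "(1 / r powr \<beta>) powr q = 1 / r ^ CARD('n)"
      using r \<beta> by (simp add: powr_divide powr_powr powr_realpow)
    then show ?thesis using r by (simp add: R_def power_mult_distrib)
  qed
  finally have f_int: "(\<integral>\<^sup>+y\<in>ball a R. ennreal (norm (f y)) \<partial>lborel) \<le>
     ennreal (r powr \<beta> * A * ((128 * real CARD('n)) ^ CARD('n) * unit_ball_vol (real CARD('n)) + 1))" .
  have "(\<integral>\<^sup>+x\<in>ball a r. near f (ball a R) x \<partial>lborel)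
    = (\<integral>\<^sup>+x. (\<integral>\<^sup>+y. ennreal (norm (K (x - y)) * norm (f y)) * indicator (ball a R) y * indicator (ball a r) x \<partial>lborel) \<partial>lborel)"
    unfolding near_def by (intro nn_integral_cong nn_integral_multc[symmetric]) measurable
  also have "\<dots> = (\<integral>\<^sup>+y. (\<integral>\<^sup>+x. ennreal (norm (K (x - y)) * norm (f y)) * indicator (ball a R) y * indicator (ball a r) x \<partial>lborel) \<partial>lborel)"
    by (rule lborel_pair.Fubini') measurable
  also have "\<dots> \<le> (\<integral>\<^sup>+y. ennreal (C_near * (R + r) powr \<alpha>) * (ennreal (norm (f y)) * indicator (ball a R) y) \<partial>lborel)"
  proof (intro nn_integral_mono)
    fix y
    show "(\<integral>\<^sup>+x. ennreal (norm (K (x - y)) * norm (f y)) * indicator (ball a R) y * indicator (ball a r) x \<partial>lborel)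
      \<le> ennreal (C_near * (R + r) powr \<alpha>) * (ennreal (norm (f y)) * indicator (ball a R) y)"
    proof (cases "y \<in> ball a R")
      case True
      have "(\<integral>\<^sup>+x. ennreal (norm (K (x - y)) * norm (f y)) * indicator (ball a R) y * indicator (ball a r) x \<partial>lborel)
        \<le> (\<integral>\<^sup>+x. ennreal (norm (f y)) * (ennreal (norm (K (x - y))) * indicator (ball 0 (R + r)) (x - y)) \<partial>lborel)"
      proof (intro nn_integral_mono)
        fix x
        have "x - y \<in> ball 0 (R + r)" if "x \<in> ball a r"
          using that True dist_triangle[of x y a] by (simp add: dist_norm norm_minus_commute)
        then show "ennreal (norm (K (x - y)) * norm (f y)) * indicator (ball a R) y * indicator (ball a r) x
          \<le> ennreal (norm (f y)) * (ennreal (norm (K (x - y))) * indicator (ball 0 (R + r)) (x - y))"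
          by (auto simp: indicator_def ennreal_mult mult.commute)
      qed
      also have "\<dots> = ennreal (norm (f y)) * (\<integral>\<^sup>+x. ennreal (norm (K (x - y))) * indicator (ball 0 (R + r)) (x - y) \<partial>lborel)"
        by (rule nn_integral_cmult) measurable
      also have "(\<integral>\<^sup>+x. ennreal (norm (K (x - y))) * indicator (ball 0 (R + r)) (x - y) \<partial>lborel) =
          (\<integral>\<^sup>+x\<in>ball 0 (R + r). ennreal (norm (K x)) \<partial>lborel)"
        by (rule nn_integral_lborel_translate) measurable
      also have "ennreal (norm (f y)) * \<dots> \<le> ennreal (norm (f y)) * ennreal (C_near * (R + r) powr \<alpha>)"
        using R r by (intro mult_left_mono nn_integral_K_ball_le) auto
      finally show ?thesis using True by (simp add: mult.commute)
    qed simp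
  qed
  also have "\<dots> = ennreal (C_near * (R + r) powr \<alpha>) * (\<integral>\<^sup>+y\<in>ball a R. ennreal (norm (f y)) \<partial>lborel)"
    by (rule nn_integral_cmult) measurable
  also have "\<dots> \<le> ennreal (C_near * (R + r) powr \<alpha>) *
     ennreal (r powr \<beta> * A * ((128 * real CARD('n)) ^ CARD('n) * unit_ball_vol (real CARD('n)) + 1))"
    by (intro mult_left_mono f_int) simp
  also have "\<dots> = ennreal (C_osc_near * A * r ^ CARD('n))"
  proof -
    have "(R + r) powr \<alpha> = (128 * real CARD('n) + 1) powr \<alpha> * r powr \<alpha>"
      using r by (simp add: R_def distrib_right flip: powr_mult)
    moreover have "r powr \<beta> * r powr \<alpha> = r ^ CARD('n)"
      using r \<beta>(3) by (simp add: powr_realpow flip: powr_add)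
    ultimately have eq: "C_near * (R + r) powr \<alpha> * (r powr \<beta> * A * ((128 * real CARD('n)) ^ CARD('n) * unit_ball_vol (real CARD('n)) + 1))
      = C_osc_near * A * r ^ CARD('n)"
      by (simp add: C_osc_near_def mult_ac)
    have c: "0 \<le> C_near * (R + r) powr \<alpha>" using C_near_nonneg by simp
    show ?thesis unfolding ennreal_mult'[OF c, symmetric] eq ..
  qed
  finally show ?thesis by (simp add: R_def)
qed

definition "C_osc_far = (unit_ball_vol (real CARD('n)) * C_far + (unit_ball_vol (real CARD('n)))\<^sup>2) * (\<Sum>k. d k)"

lemma far_annulus_le:
  assumes f[measurable]: "f \<in> borel_measurable borel" and p: "p = real CARD('n) / \<alpha>"
    and A: "0 < A" "(\<integral>\<^sup>+y. ennreal (norm (f y) powr p) \<partial>lborel) \<le> ennreal (A powr p)"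
    and r: "0 < r" and R: "R = 128 * real CARD('n) * r * 2 ^ k"
  shows "(\<integral>\<^sup>+x\<in>ball a r. (\<integral>\<^sup>+x'\<in>ball a r. far f {y. R \<le> dist a y \<and> dist a y < 2 * R} x x' \<partial>lborel) \<partial>lborel)
    \<le> ennreal (d k * A * (r ^ CARD('n) * r ^ CARD('n)) * (unit_ball_vol (real CARD('n)) * C_far + (unit_ball_vol (real CARD('n)))\<^sup>2))"
proof -
  define D where "D = {y. R \<le> dist a y \<and> dist a y < 2 * R}"
  have [measurable]: "D \<in> sets borel" unfolding D_def by measurable
  have [measurable]: "ball (b::real^'n) t \<in> sets borel" for b t by simp
  note pq = conjugate_exponents[OF p]
  have dk: "d k > 0" by (rule d_pos)
  define V where "V = unit_ball_vol (real CARD('n)) * r ^ CARD('n)"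
  have V: "V \<ge> 0" "emeasure lborel (ball a r) = ennreal V" using r by (auto simp: V_def emeasure_ball)
  define Q where "Q x x' = (\<integral>\<^sup>+y\<in>D. ennreal (norm (K (x - y) - K (x' - y)) powr q) \<partial>lborel)" for x x'
  have [measurable]: "(\<lambda>(x, x'). Q x x') \<in> borel_measurable (borel \<Otimes>\<^sub>M borel)"
    unfolding Q_def[abs_def] by measurable
  have far_le: "far f D x x' \<le> ennreal (d k * A / d k powr q) * Q x x' + ennreal (d k * A)" for x x'
  proof -
    have "far f D x x' \<le> (\<integral>\<^sup>+y. ennreal (d k * A / d k powr q) * (ennreal (norm (K (x - y) - K (x' - y)) powr q) * indicator D y)
        + ennreal (d k * A / A powr p) * ennreal (norm (f y) powr p) \<partial>lborel)"
      unfolding far_def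
    proof (intro nn_integral_mono)
      fix y
      have "norm (K (x - y) - K (x' - y)) * norm (f y) \<le>
        d k * A * ((norm (K (x - y) - K (x' - y)) / d k) powr q + (norm (f y) / A) powr p)"
        using pq q_gt_1 A dk by (intro Youngs_inequality_scaled) auto
      also have "\<dots> = d k * A / d k powr q * norm (K (x - y) - K (x' - y)) powr q + d k * A / A powr p * norm (f y) powr p"
        using A dk by (simp add: powr_divide algebra_simps)
      finally show "ennreal (norm (K (x - y) - K (x' - y)) * norm (f y)) * indicator D y \<le>
        ennreal (d k * A / d k powr q) * (ennreal (norm (K (x - y) - K (x' - y)) powr q) * indicator D y)
        + ennreal (d k * A / A powr p) * ennreal (norm (f y) powr p)"
        using A dk by (auto simp: indicator_def ennreal_mult[symmetric] simp flip: ennreal_plus)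
    qed
    also have "\<dots> = ennreal (d k * A / d k powr q) * Q x x'
        + ennreal (d k * A / A powr p) * (\<integral>\<^sup>+y. ennreal (norm (f y) powr p) \<partial>lborel)"
      by (subst nn_integral_add) (auto simp: nn_integral_cmult Q_def)
    also have "\<dots> \<le> ennreal (d k * A / d k powr q) * Q x x'
        + ennreal (d k * A / A powr p) * ennreal (A powr p)"
      by (intro add_left_mono mult_left_mono A) simp
    finally show ?thesis using A dk by (simp add: ennreal_mult[symmetric])
  qed
  have "(\<integral>\<^sup>+x\<in>ball a r. (\<integral>\<^sup>+x'\<in>ball a r. far f D x x' \<partial>lborel) \<partial>lborel) \<le>
    (\<integral>\<^sup>+x\<in>ball a r. (ennreal (d k * A / d k powr q) * (\<integral>\<^sup>+x'\<in>ball a r. Q x x' \<partial>lborel) + ennreal (d k * A) * ennreal V) \<partial>lborel)"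
  proof (intro nn_integral_mono mult_right_mono)
    fix x
    have "(\<integral>\<^sup>+x'\<in>ball a r. far f D x x' \<partial>lborel) \<le>
      (\<integral>\<^sup>+x'. ennreal (d k * A / d k powr q) * (Q x x' * indicator (ball a r) x') + ennreal (d k * A) * indicator (ball a r) x' \<partial>lborel)"
      using far_le[of x] by (intro nn_integral_mono) (simp split: split_indicator)
    also have "\<dots> = ennreal (d k * A / d k powr q) * (\<integral>\<^sup>+x'\<in>ball a r. Q x x' \<partial>lborel) + ennreal (d k * A) * ennreal V"
      by (subst nn_integral_add) (auto simp: nn_integral_cmult V(2))
    finally show "(\<integral>\<^sup>+x'\<in>ball a r. far f D x x' \<partial>lborel) \<le>
       ennreal (d k * A / d k powr q) * (\<integral>\<^sup>+x'\<in>ball a r. Q x x' \<partial>lborel) + ennreal (d k * A) * ennreal V" .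
  qed simp
  also have "\<dots> = (\<integral>\<^sup>+x. ennreal (d k * A / d k powr q) * ((\<integral>\<^sup>+x'\<in>ball a r. Q x x' \<partial>lborel) * indicator (ball a r) x)
      + ennreal (d k * A) * ennreal V * indicator (ball a r) x \<partial>lborel)"
    by (simp add: distrib_left distrib_right mult_ac)
  also have "\<dots> = ennreal (d k * A / d k powr q) * (\<integral>\<^sup>+x\<in>ball a r. (\<integral>\<^sup>+x'\<in>ball a r. Q x x' \<partial>lborel) \<partial>lborel)
      + ennreal (d k * A) * ennreal V * ennreal V"
    by (subst nn_integral_add) (auto simp: nn_integral_cmult V(2))
  also have "\<dots> \<le> ennreal (d k * A / d k powr q) *
      ennreal (unit_ball_vol (real CARD('n)) * C_far * (r ^ CARD('n) * r ^ CARD('n)) * d k powr q)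
      + ennreal (d k * A) * ennreal V * ennreal V"
    unfolding Q_def D_def by (intro add_right_mono mult_left_mono far_power_le[OF r R]) simp
  also have "\<dots> = ennreal (d k * A / d k powr q * (unit_ball_vol (real CARD('n)) * C_far * (r ^ CARD('n) * r ^ CARD('n)) * d k powr q) + d k * A * V * V)"
    using A dk r V(1) C_far_nonneg by (simp add: ennreal_mult[symmetric] flip: ennreal_plus)
  also have "d k * A / d k powr q * (unit_ball_vol (real CARD('n)) * C_far * (r ^ CARD('n) * r ^ CARD('n)) * d k powr q) + d k * A * V * V
    = d k * A * (r ^ CARD('n) * r ^ CARD('n)) * (unit_ball_vol (real CARD('n)) * C_far + (unit_ball_vol (real CARD('n)))\<^sup>2)"
    using dk by (simp add: V_def power2_eq_square algebra_simps)
  finally show ?thesis by (simp add: D_def)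
qed

lemma far_integral_le:
  assumes f[measurable]: "f \<in> borel_measurable borel" and p: "p = real CARD('n) / \<alpha>"
    and A: "0 < A" "(\<integral>\<^sup>+y. ennreal (norm (f y) powr p) \<partial>lborel) \<le> ennreal (A powr p)"
    and r: "0 < r"
  shows "(\<integral>\<^sup>+x\<in>ball a r. (\<integral>\<^sup>+x'\<in>ball a r. far f (- ball a (128 * real CARD('n) * r)) x x' \<partial>lborel) \<partial>lborel)
    \<le> ennreal (C_osc_far * A * (r ^ CARD('n) * r ^ CARD('n)))"
proof -
  define R where "R = 128 * real CARD('n) * r"
  have R: "R > 0" using r by (simp add: R_def)
  define D where "D k = {y. R * 2 ^ k \<le> dist a y \<and> dist a y < 2 * (R * 2 ^ k)}" for k :: nat
  have [measurable]: "D k \<in> sets borel" for k unfolding D_def by measurable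
  have [measurable]: "ball (b::real^'n) t \<in> sets borel" for b t by simp
  have far_le: "far f (- ball a R) x x' \<le> (\<Sum>k. far f (D k) x x')" for x x'
  proof -
    let ?g = "\<lambda>y. ennreal (norm (K (x - y) - K (x' - y)) * norm (f y))"
    have "far f (- ball a R) x x' \<le> (\<integral>\<^sup>+y. (\<Sum>k. ?g y * indicator (D k) y) \<partial>lborel)"
      unfolding far_def
    proof (intro nn_integral_mono)
      fix y
      show "?g y * indicator (- ball a R) y \<le> (\<Sum>k. ?g y * indicator (D k) y)"
      proof (cases "y \<in> ball a R")
        case False
        then obtain k where "y \<in> D k"
          using ex_dyadic_annulus_outer[OF R, of "dist a y"] by (auto simp: D_def)
        then have "?g y * indicator (- ball a R) y \<le> ?g y * indicator (D k) y"
          by (simp split: split_indicator)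
        also have "\<dots> \<le> (\<Sum>k. ?g y * indicator (D k) y)"
          by (rule ennreal_le_suminf)
        finally show ?thesis .
      qed simp
    qed
    also have "\<dots> = (\<Sum>k. far f (D k) x x')"
      unfolding far_def by (rule nn_integral_suminf) measurable
    finally show ?thesis .
  qed
  have "(\<integral>\<^sup>+x\<in>ball a r. (\<integral>\<^sup>+x'\<in>ball a r. far f (- ball a R) x x' \<partial>lborel) \<partial>lborel) \<le>
    (\<integral>\<^sup>+x\<in>ball a r. (\<integral>\<^sup>+x'. (\<Sum>k. far f (D k) x x' * indicator (ball a r) x') \<partial>lborel) \<partial>lborel)"
    using far_le by (intro nn_integral_mono mult_right_mono) (auto simp: ennreal_suminf_multc intro!: mult_right_mono)
  also have "\<dots> = (\<integral>\<^sup>+x. (\<Sum>k. (\<integral>\<^sup>+x'\<in>ball a r. far f (D k) x x' \<partial>lborel) * indicator (ball a r) x) \<partial>lborel)"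
  proof (intro nn_integral_cong)
    fix x
    have "(\<integral>\<^sup>+x'. (\<Sum>k. far f (D k) x x' * indicator (ball a r) x') \<partial>lborel) =
      (\<Sum>k. \<integral>\<^sup>+x'\<in>ball a r. far f (D k) x x' \<partial>lborel)"
      by (rule nn_integral_suminf) measurable
    then show "(\<integral>\<^sup>+x'. (\<Sum>k. far f (D k) x x' * indicator (ball a r) x') \<partial>lborel) * indicator (ball a r) x =
      (\<Sum>k. (\<integral>\<^sup>+x'\<in>ball a r. far f (D k) x x' \<partial>lborel) * indicator (ball a r) x)"
      by (simp only: ennreal_suminf_multc)
  qed
  also have "\<dots> = (\<Sum>k. \<integral>\<^sup>+x\<in>ball a r. (\<integral>\<^sup>+x'\<in>ball a r. far f (D k) x x' \<partial>lborel) \<partial>lborel)"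
    by (rule nn_integral_suminf) measurable
  also have "\<dots> \<le> (\<Sum>k. ennreal (A * (r ^ CARD('n) * r ^ CARD('n)) * (unit_ball_vol (real CARD('n)) * C_far + (unit_ball_vol (real CARD('n)))\<^sup>2) * d k))"
  proof (intro suminf_le summableI)
    fix k
    show "(\<integral>\<^sup>+x\<in>ball a r. (\<integral>\<^sup>+x'\<in>ball a r. far f (D k) x x' \<partial>lborel) \<partial>lborel)
      \<le> ennreal (A * (r ^ CARD('n) * r ^ CARD('n)) * (unit_ball_vol (real CARD('n)) * C_far + (unit_ball_vol (real CARD('n)))\<^sup>2) * d k)"
      using far_annulus_le[OF f p A r refl, where a=a and k=k] by (simp add: D_def R_def mult_ac)
  qed
  also have "\<dots> = ennreal (A * (r ^ CARD('n) * r ^ CARD('n)) * (unit_ball_vol (real CARD('n)) * C_far + (unit_ball_vol (real CARD('n)))\<^sup>2) * (\<Sum>k. d k))"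
    using A r C_far_nonneg d_pos by (intro suminf_ennreal_eq sums_mult summable_sums d) (auto simp: less_imp_le)
  finally show ?thesis by (simp add: R_def C_osc_far_def mult_ac)
qed

definition "C_osc = 2 * unit_ball_vol (real CARD('n)) * C_osc_near + C_osc_far"

lemma C_osc_nonneg: "0 \<le> C_osc"
  using C_near_nonneg C_far_nonneg suminf_nonneg[OF d(2)] d_pos
  by (simp add: C_osc_def C_osc_near_def C_osc_far_def less_imp_le)

lemma T_oscillation_le:
  assumes f[measurable]: "f \<in> borel_measurable borel" and p: "p = real CARD('n) / \<alpha>"
    and A: "0 < A" "(\<integral>\<^sup>+y. ennreal (norm (f y) powr p) \<partial>lborel) \<le> ennreal (A powr p)"
    and r: "0 < r"
  shows "(\<integral>\<^sup>+x\<in>ball a r. (\<integral>\<^sup>+x'\<in>ball a r. ennreal (norm (T f x - T f x')) \<partial>lborel) \<partial>lborel)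
    \<le> ennreal (C_osc * A * (r ^ CARD('n))\<^sup>2)"
proof -
  define S where "S = ball a (128 * real CARD('n) * r)"
  have [measurable]: "S \<in> sets borel" "ball (b::real^'n) t \<in> sets borel" for b t by (simp_all add: S_def)
  define V where "V = unit_ball_vol (real CARD('n)) * r ^ CARD('n)"
  have V: "V \<ge> 0" "emeasure lborel (ball a r) = ennreal V" using r by (auto simp: V_def emeasure_ball)
  have near0: "0 \<le> C_osc_near" using C_near_nonneg by (simp add: C_osc_near_def)
  have far0: "0 \<le> C_osc_far" using C_far_nonneg suminf_nonneg[OF d(2)] d_pos by (simp add: C_osc_far_def less_imp_le)
  define I where "I = (\<integral>\<^sup>+x\<in>ball a r. near f S x \<partial>lborel)"
  have "(\<integral>\<^sup>+x\<in>ball a r. (\<integral>\<^sup>+x'\<in>ball a r. ennreal (norm (T f x - T f x')) \<partial>lborel) \<partial>lborel)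
    \<le> (\<integral>\<^sup>+x\<in>ball a r. (near f S x * ennreal V + I + (\<integral>\<^sup>+x'\<in>ball a r. far f (- S) x x' \<partial>lborel)) \<partial>lborel)"
  proof (intro nn_integral_mono mult_right_mono)
    fix x
    have "(\<integral>\<^sup>+x'\<in>ball a r. ennreal (norm (T f x - T f x')) \<partial>lborel) \<le>
      (\<integral>\<^sup>+x'. near f S x * indicator (ball a r) x' + near f S x' * indicator (ball a r) x'
         + far f (- S) x x' * indicator (ball a r) x' \<partial>lborel)"
      using norm_T_diff_le[OF f, of S x] by (intro nn_integral_mono) (simp split: split_indicator)
    also have "\<dots> = near f S x * ennreal V + I + (\<integral>\<^sup>+x'\<in>ball a r. far f (- S) x x' \<partial>lborel)"
      by (simp add: nn_integral_add nn_integral_cmult V(2) I_def)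
    finally show "(\<integral>\<^sup>+x'\<in>ball a r. ennreal (norm (T f x - T f x')) \<partial>lborel) \<le>
      near f S x * ennreal V + I + (\<integral>\<^sup>+x'\<in>ball a r. far f (- S) x x' \<partial>lborel)" .
  qed simp
  also have "\<dots> = (\<integral>\<^sup>+x. ennreal V * (near f S x * indicator (ball a r) x) + I * indicator (ball a r) x
     + (\<integral>\<^sup>+x'\<in>ball a r. far f (- S) x x' \<partial>lborel) * indicator (ball a r) x \<partial>lborel)"
    by (simp add: distrib_left distrib_right mult_ac)
  also have "\<dots> = ennreal V * I + I * ennreal V
     + (\<integral>\<^sup>+x\<in>ball a r. (\<integral>\<^sup>+x'\<in>ball a r. far f (- S) x x' \<partial>lborel) \<partial>lborel)"
    by (simp add: nn_integral_add nn_integral_cmult V(2) I_def)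
  also have "\<dots> \<le> ennreal V * ennreal (C_osc_near * A * r ^ CARD('n)) + ennreal (C_osc_near * A * r ^ CARD('n)) * ennreal V
     + ennreal (C_osc_far * A * (r ^ CARD('n) * r ^ CARD('n)))"
    unfolding I_def S_def
    by (intro add_mono mult_left_mono mult_right_mono near_integral_le[OF f p A r] far_integral_le[OF f p A r]) auto
  also have "\<dots> = ennreal (V * (C_osc_near * A * r ^ CARD('n)) + C_osc_near * A * r ^ CARD('n) * V
     + C_osc_far * A * (r ^ CARD('n) * r ^ CARD('n)))"
    using A r V(1) near0 far0 by (simp add: ennreal_mult[symmetric] flip: ennreal_plus)
  also have "V * (C_osc_near * A * r ^ CARD('n)) + C_osc_near * A * r ^ CARD('n) * V
     + C_osc_far * A * (r ^ CARD('n) * r ^ CARD('n)) = C_osc * A * (r ^ CARD('n))\<^sup>2"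
    by (simp add: C_osc_def V_def power2_eq_square algebra_simps)
  finally show ?thesis .
qed

end

section \<open>Mean oscillation and completions\<close>

lemma completion_ex_borel_measurable_complex:
  fixes f :: "'a \<Rightarrow> complex"
  assumes [measurable]: "f \<in> borel_measurable (completion M)"
  shows "\<exists>g\<in>borel_measurable M. AE x in M. f x = g x"
proof -
  have "(\<lambda>x. Re (f x)) \<in> borel_measurable (completion M)" "(\<lambda>x. Im (f x)) \<in> borel_measurable (completion M)"
    by measurable
  then obtain u v where u: "u \<in> borel_measurable M" "AE x in M. Re (f x) = u x"
    and v: "v \<in> borel_measurable M" "AE x in M. Im (f x) = v x"
    using completion_ex_borel_measurable_real[of "\<lambda>x. Re (f x)" M]
      completion_ex_borel_measurable_real[of "\<lambda>x. Im (f x)" M] by blast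
  note [measurable] = u(1) v(1)
  have "(\<lambda>x. complex_of_real (u x) + \<i> * complex_of_real (v x)) \<in> borel_measurable M"
    by measurable
  moreover have "AE x in M. f x = complex_of_real (u x) + \<i> * complex_of_real (v x)"
    using u(2) v(2) by eventually_elim (simp add: complex_eq_iff)
  ultimately show ?thesis by (intro bexI[of _ "\<lambda>x. complex_of_real (u x) + \<i> * complex_of_real (v x)"])
qed

lemma measurable_completion_AE:
  assumes f: "f \<in> M \<rightarrow>\<^sub>M N" and ae: "AE x in M. f x = g x" and sp: "\<And>x. x \<in> space M \<Longrightarrow> g x \<in> space N"
  shows "g \<in> completion M \<rightarrow>\<^sub>M N"
proof (rule measurableI)
  fix A assume A: "A \<in> sets N"
  have "AE x in completion M. x \<in> f -` A \<inter> space M \<longleftrightarrow> x \<in> g -` A \<inter> space M"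
    using AE_completion[OF ae] by eventually_elim auto
  then have "g -` A \<inter> space M \<in> sets (completion M)"
    by (rule completion.in_sets_AE) (use measurable_sets[OF f A] in auto)
  then show "g -` A \<inter> space (completion M) \<in> sets (completion M)" by simp
qed (use sp in simp)

lemma integral_completion_AE:
  fixes f g :: "'a \<Rightarrow> 'b::{banach, second_countable_topology}"
  assumes f: "f \<in> borel_measurable M" and ae: "AE x in M. f x = g x"
  shows "integral\<^sup>L (completion M) g = integral\<^sup>L M f"
    and "integrable (completion M) g \<longleftrightarrow> integrable M f"
proof -
  have g: "g \<in> borel_measurable (completion M)" by (rule measurable_completion_AE[OF f ae]) simp
  have f': "f \<in> borel_measurable (completion M)" using f by (rule measurable_completion)
  show "integral\<^sup>L (completion M) g = integral\<^sup>L M f"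
    using integral_cong_AE[OF f' g AE_completion[OF ae]] integral_completion[OF f] by simp
  show "integrable (completion M) g \<longleftrightarrow> integrable M f"
    using integrable_cong_AE[OF f' g AE_completion[OF ae]] integrable_completion[OF f] by simp
qed

lemma AE_lborel_affine:
  fixes t :: "'a::euclidean_space"
  assumes c: "c \<noteq> 0" and ae: "AE x in lborel. Q x"
  shows "AE x in lborel. Q (t + c *\<^sub>R x)"
proof -
  have "AE x in density (distr lborel borel (\<lambda>x. t + c *\<^sub>R x)) (\<lambda>_. ennreal (\<bar>c\<bar> ^ DIM('a))). Q x"
    using ae unfolding lborel_affine[OF c, of t, symmetric] .
  then have "AE x in distr lborel borel (\<lambda>x. t + c *\<^sub>R x). Q x"
    using c by (subst (asm) AE_density) auto
  then show ?thesis by (rule AE_distrD[rotated]) measurable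
qed

lemma AE_lborel_orthogonal:
  fixes \<rho> :: "real^'n^'n"
  assumes \<rho>: "orthogonal_matrix \<rho>" and ae: "AE x in lborel. Q x"
  shows "AE x in lborel. Q (\<rho> *v x)"
proof -
  have "{x. \<not> Q x} \<in> null_sets lebesgue"
    using completion.AE_iff_null_sets[where M=lborel and P=Q] AE_completion[OF ae] by simp
  then have "negligible {x. \<not> Q x}" by (simp add: negligible_iff_null_sets)
  then have "negligible ((*v) (transpose \<rho>) ` {x. \<not> Q x})"
    by (intro negligible_differentiable_image_negligible linear_imp_differentiable_on matrix_vector_mul_linear) simp_all
  moreover have "{x. \<not> Q (\<rho> *v x)} \<subseteq> (*v) (transpose \<rho>) ` {x. \<not> Q x}"
  proof
    fix x assume "x \<in> {x. \<not> Q (\<rho> *v x)}"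
    moreover have "x = transpose \<rho> *v (\<rho> *v x)"
      using \<rho> unfolding matrix_vector_mul_assoc by (simp only: orthogonal_matrix_def matrix_vector_mul_lid)
    ultimately show "x \<in> (*v) (transpose \<rho>) ` {x. \<not> Q x}" by blast
  qed
  ultimately have "negligible {x. \<not> Q (\<rho> *v x)}" by (rule negligible_subset)
  then have "AE x in lebesgue. Q (\<rho> *v x)"
    using completion.AE_iff_null_sets[where M=lborel and P="\<lambda>x. Q (\<rho> *v x)"] by (simp add: negligible_iff_null_sets)
  then show ?thesis by (simp add: AE_completion_iff)
qed

lemma mean_oscillation_le:
  fixes g :: "'a::euclidean_space \<Rightarrow> complex" and a :: 'a
  assumes g [measurable]: "g \<in> borel_measurable borel" and r: "0 < r" and c: "0 \<le> c"
    and osc: "(\<integral>\<^sup>+x\<in>ball a r. (\<integral>\<^sup>+x'\<in>ball a r. ennreal (norm (g x - g x')) \<partial>lborel) \<partial>lborel) \<le> ennreal c"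
  shows "set_integrable lebesgue (ball a r) g"
    and "mean_on (ball a r) (\<lambda>x. norm (g x - mean_on (ball a r) g)) \<le> c / (measure lebesgue (ball a r))\<^sup>2"
proof -
  define B where "B = ball a r"
  have [measurable]: "B \<in> sets borel" by (simp add: B_def)
  define m where "m = measure lebesgue B"
  have m: "m > 0" using r by (simp add: m_def B_def content_ball_pos)
  have mB: "emeasure lborel B = ennreal m" "measure lborel B = m" "emeasure lborel B < \<infinity>"
    using r by (simp_all add: m_def B_def emeasure_ball content_ball)
  define h where "h x = (\<integral>\<^sup>+x'\<in>B. ennreal (norm (g x - g x')) \<partial>lborel)" for x
  have [measurable]: "h \<in> borel_measurable borel" unfolding h_def[abs_def] by measurable
  have hc: "(\<integral>\<^sup>+x\<in>B. h x \<partial>lborel) \<le> ennreal c" using osc by (simp add: h_def B_def)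
  have "\<exists>x\<in>B. h x < \<infinity>"
  proof (rule ccontr)
    assume "\<not> ?thesis"
    then have "(\<integral>\<^sup>+x\<in>B. h x \<partial>lborel) = (\<integral>\<^sup>+x\<in>B. \<infinity> \<partial>lborel)"
      by (intro nn_integral_cong) (auto simp: indicator_def not_less top_unique)
    also have "\<dots> = \<infinity> * emeasure lborel B" by (rule nn_integral_cmult_indicator) simp
    also have "\<dots> = \<infinity>" using m mB by (simp add: ennreal_top_mult)
    finally show False using hc by (simp add: top_unique)
  qed
  then obtain x0 where x0: "x0 \<in> B" "h x0 < \<infinity>" by blast
  have int: "integrable lborel (\<lambda>x. indicator B x *\<^sub>R g x)"
  proof (rule integrableI_bounded)
    have "(\<integral>\<^sup>+x. ennreal (norm (indicator B x *\<^sub>R g x)) \<partial>lborel) \<le>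
      (\<integral>\<^sup>+x. ennreal (norm (g x0)) * indicator B x + ennreal (norm (g x0 - g x)) * indicator B x \<partial>lborel)"
    proof (intro nn_integral_mono)
      fix x
      have "norm (g x) \<le> norm (g x0) + norm (g x0 - g x)"
        by (metis norm_minus_commute norm_triangle_sub)
      then show "ennreal (norm (indicator B x *\<^sub>R g x)) \<le> ennreal (norm (g x0)) * indicator B x + ennreal (norm (g x0 - g x)) * indicator B x"
        by (simp add: indicator_def ennreal_leI flip: ennreal_plus)
    qed
    also have "\<dots> = ennreal (norm (g x0)) * ennreal m + h x0"
      by (simp add: nn_integral_add nn_integral_cmult mB h_def)
    also have "\<dots> < \<infinity>" using x0(2) by (simp add: ennreal_mult_less_top)
    finally show "(\<integral>\<^sup>+x. ennreal (norm (indicator B x *\<^sub>R g x)) \<partial>lborel) < \<infinity>" .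
  qed simp
  then show "set_integrable lebesgue (ball a r) g"
    unfolding set_integrable_def B_def[symmetric] by (subst integrable_completion) simp_all
  define \<mu> where "\<mu> = mean_on B g"
  have \<mu>: "\<mu> = (\<integral>x. indicator B x *\<^sub>R g x \<partial>lborel) /\<^sub>R m"
    by (simp add: \<mu>_def mean_on_def set_lebesgue_integral_def m_def integral_completion)
  have constB: "integrable lborel (\<lambda>x. indicator B x *\<^sub>R (z::complex))" for z
    using mB(3) by (intro integrable_scaleR_left integrable_real_indicator) auto
  have dev: "ennreal (norm (g x - \<mu>)) \<le> ennreal (1 / m) * h x" for x
  proof -
    have intx: "integrable lborel (\<lambda>x'. indicator B x' *\<^sub>R g x - indicator B x' *\<^sub>R g x')"
      by (rule Bochner_Integration.integrable_diff[OF constB int])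
    have "(\<integral>x'. indicator B x' *\<^sub>R g x - indicator B x' *\<^sub>R g x' \<partial>lborel) = m *\<^sub>R (g x - \<mu>)"
      using m mB by (subst Bochner_Integration.integral_diff[OF constB int]) (simp add: \<mu> algebra_simps)
    then have "ennreal (norm (m *\<^sub>R (g x - \<mu>))) \<le> (\<integral>\<^sup>+x'. ennreal (norm (indicator B x' *\<^sub>R g x - indicator B x' *\<^sub>R g x')) \<partial>lborel)"
      using integral_norm_bound_ennreal[OF intx] by simp
    also have "\<dots> = h x"
      unfolding h_def by (intro nn_integral_cong) (simp split: split_indicator)
    finally have "ennreal (1 / m) * ennreal (norm (m *\<^sub>R (g x - \<mu>))) \<le> ennreal (1 / m) * h x"
      by (rule mult_left_mono) simp
    then show ?thesis using m by (simp add: ennreal_mult[symmetric])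
  qed
  have int_dev: "integrable lborel (\<lambda>x. indicator B x *\<^sub>R norm (g x - \<mu>))"
  proof -
    have "integrable lborel (\<lambda>x. norm (indicator B x *\<^sub>R g x - indicator B x *\<^sub>R \<mu>))"
      by (intro integrable_norm Bochner_Integration.integrable_diff int constB)
    then show ?thesis by (simp flip: scaleR_diff_right)
  qed
  have "ennreal (\<integral>x. indicator B x *\<^sub>R norm (g x - \<mu>) \<partial>lborel) = (\<integral>\<^sup>+x. ennreal (indicator B x *\<^sub>R norm (g x - \<mu>)) \<partial>lborel)"
    by (rule nn_integral_eq_integral[OF int_dev, symmetric]) simp
  also have "\<dots> \<le> (\<integral>\<^sup>+x. ennreal (1 / m) * (h x * indicator B x) \<partial>lborel)"
    using dev by (intro nn_integral_mono) (simp split: split_indicator)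
  also have "\<dots> = ennreal (1 / m) * (\<integral>\<^sup>+x\<in>B. h x \<partial>lborel)"
    by (rule nn_integral_cmult) measurable
  also have "\<dots> \<le> ennreal (1 / m) * ennreal c" by (intro mult_left_mono hc) simp
  also have "\<dots> = ennreal (c / m)" using m c by (simp add: ennreal_mult[symmetric])
  finally have "(\<integral>x. indicator B x *\<^sub>R norm (g x - \<mu>) \<partial>lborel) \<le> c / m"
    using m c by (subst (asm) ennreal_le_iff) auto
  then have "(\<integral>x. indicator B x *\<^sub>R norm (g x - \<mu>) \<partial>lborel) /\<^sub>R m \<le> c / m\<^sup>2"
    using m by (simp add: field_simps power2_eq_square)
  then show "mean_on (ball a r) (\<lambda>x. norm (g x - mean_on (ball a r) g)) \<le> c / (measure lebesgue (ball a r))\<^sup>2"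
    unfolding B_def[symmetric] \<mu>_def[symmetric] m_def[symmetric]
    by (simp add: mean_on_def set_lebesgue_integral_def m_def integral_completion)
qed

section \<open>The normalized surface measure\<close>

definition sphere_borel :: "'a::euclidean_space measure" where
  "sphere_borel = distr (uniform_measure lborel (ball 0 1)) borel sgn"

lemma sphere_measure_eq: "sphere_measure = completion sphere_borel"
  by (simp add: sphere_measure_def sphere_borel_def)

lemma sets_sphere_borel [simp, measurable_cong]: "sets sphere_borel = sets borel"
  and space_sphere_borel [simp]: "space sphere_borel = UNIV"
  by (simp_all add: sphere_borel_def)

lemma borel_measurable_sgn_euclidean [measurable]: "sgn \<in> borel_measurable (borel :: 'a::euclidean_space measure)"
  unfolding sgn_div_norm[abs_def] by measurable

lemma unit_ball_vol_neq_0 [simp]: "0 \<le> n \<Longrightarrow> unit_ball_vol n \<noteq> 0"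
  using unit_ball_vol_pos[of n] by linarith

lemma emeasure_unit_ball:
  "emeasure lborel (ball (0::'a::euclidean_space) 1) = ennreal (unit_ball_vol (real DIM('a)))"
  by (simp add: emeasure_ball)

lemma nn_integral_sphere_borel:
  fixes F :: "'a::euclidean_space \<Rightarrow> ennreal"
  assumes [measurable]: "F \<in> borel_measurable borel"
  shows "(\<integral>\<^sup>+z\<in>ball 0 1. F (sgn z) \<partial>lborel) = ennreal (unit_ball_vol (real DIM('a))) * (\<integral>\<^sup>+x. F x \<partial>sphere_borel)"
proof -
  have "(\<integral>\<^sup>+x. F x \<partial>sphere_borel) = (\<integral>\<^sup>+z. F (sgn z) \<partial>uniform_measure lborel (ball 0 1))"
    unfolding sphere_borel_def by (rule nn_integral_distr) measurable
  also have "\<dots> = (\<integral>\<^sup>+z\<in>ball 0 1. F (sgn z) \<partial>lborel) / ennreal (unit_ball_vol (real DIM('a)))"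
    by (subst nn_integral_uniform_measure) (auto simp: emeasure_unit_ball)
  finally have eq: "(\<integral>\<^sup>+x. F x \<partial>sphere_borel) = (\<integral>\<^sup>+z\<in>ball 0 1. F (sgn z) \<partial>lborel) / ennreal (unit_ball_vol (real DIM('a)))" .
  have "ennreal (unit_ball_vol (real DIM('a))) \<noteq> 0" by simp
  then show ?thesis
    unfolding eq by (simp add: ennreal_times_divide ennreal_mult_divide_eq mult.commute[of "ennreal _"])
qed

lemma AE_sphere_borelI:
  fixes Q :: "'a::euclidean_space \<Rightarrow> bool"
  assumes ae: "AE z in lborel. Q (sgn z)" and [measurable]: "Measurable.pred borel Q"
  shows "AE x in sphere_borel. Q x"
  unfolding sphere_borel_def
proof (subst AE_distr_iff)
  show "AE z in uniform_measure lborel (ball 0 1). Q (sgn z)"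
    using ae by (intro AE_uniform_measureI) auto
qed (auto simp: pred_def[symmetric])

lemma AE_sphere_borelD:
  fixes Q :: "'a::euclidean_space \<Rightarrow> bool"
  assumes ae: "AE x in sphere_borel. Q x"
  shows "AE z in lborel. Q (sgn z)"
proof -
  have "AE z in uniform_measure lborel (ball (0::'a) 1). Q (sgn z)"
    using ae unfolding sphere_borel_def by (rule AE_distrD[rotated]) measurable
  then have "AE z in lborel. z \<in> ball (0::'a) 1 \<longrightarrow> Q (sgn z)"
    by (subst (asm) AE_uniform_measure) (auto simp: emeasure_unit_ball)
  then have "AE z in lborel. (1 / real (Suc k)) *\<^sub>R z \<in> ball (0::'a) 1 \<longrightarrow> Q (sgn ((1 / real (Suc k)) *\<^sub>R z))" for k
    using AE_lborel_affine[of "1 / real (Suc k)" "\<lambda>z. z \<in> ball (0::'a) 1 \<longrightarrow> Q (sgn z)" 0] by simp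
  then have "AE z in lborel. \<forall>k. (1 / real (Suc k)) *\<^sub>R z \<in> ball (0::'a) 1 \<longrightarrow> Q (sgn ((1 / real (Suc k)) *\<^sub>R z))"
    by (subst AE_all_countable) blast
  then show ?thesis
  proof eventually_elim
    case (elim z)
    obtain k where k: "norm z < real (Suc k)"
      using reals_Archimedean2[of "norm z"] by (metis less_trans lessI of_nat_less_iff)
    then have "(1 / real (Suc k)) *\<^sub>R z \<in> ball 0 1" by (simp add: divide_simps)
    moreover have "sgn ((1 / real (Suc k)) *\<^sub>R z) = sgn z" by (simp add: sgn_scaleR)
    ultimately show ?case using elim by metis
  qed
qed

lemma nn_integral_ball_orthogonal_le:
  fixes \<rho> :: "real^'n^'n" and F :: "real^'n \<Rightarrow> ennreal"
  assumes \<rho>: "orthogonal_matrix \<rho>" and [measurable]: "F \<in> borel_measurable borel"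
  shows "(\<integral>\<^sup>+z\<in>ball 0 1. F (\<rho> *v z) \<partial>lborel) \<le> ennreal (lip_const TYPE(real^'n)) * (\<integral>\<^sup>+z\<in>ball 0 1. F z \<partial>lborel)"
proof -
  have norm: "norm (A *v z) = norm z" if "orthogonal_matrix A" for A :: "real^'n^'n" and z
    using that orthogonal_transformation_matrix[of "(*v) A"]
    by (simp add: matrix_vector_mul_linear orthogonal_transformation)
  define \<tau> where "\<tau> = transpose \<rho>"
  have tr: "orthogonal_matrix \<tau>" using \<rho> by (simp add: \<tau>_def)
  have inv: "\<rho> *v (\<tau> *v z) = z" "\<tau> *v (\<rho> *v z) = z" for z
    using \<rho> unfolding matrix_vector_mul_assoc \<tau>_def by (simp_all only: orthogonal_matrix_def matrix_vector_mul_lid)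
  have [measurable]: "(*v) A \<in> borel_measurable borel" for A :: "real^'n^'n"
    by (intro borel_measurable_continuous_onI linear_continuous_on matrix_vector_mul_bounded_linear)
  have "(\<integral>\<^sup>+z\<in>ball 0 1. F (\<rho> *v z) \<partial>lborel) \<le> ennreal (lip_const TYPE(real^'n) * 1 ^ DIM(real^'n)) *
      (\<integral>\<^sup>+z\<in>ball 0 1. F (\<rho> *v (\<tau> *v z)) \<partial>lborel)"
  proof (rule nn_integral_lipschitz_le)
    show "1-lipschitz_on (ball 0 1) ((*v) \<tau>)"
      by (intro lipschitz_onI) (simp_all add: dist_norm norm[OF tr] flip: matrix_vector_mult_diff_distrib)
    show "ball 0 1 \<subseteq> (*v) \<tau> ` ball 0 1"
    proof
      fix z :: "real^'n" assume "z \<in> ball 0 1"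
      then have "\<rho> *v z \<in> ball 0 1" by (simp add: norm[OF \<rho>])
      then show "z \<in> (*v) \<tau> ` ball 0 1" using inv(2)[of z] by (metis image_eqI)
    qed
  qed auto
  then show ?thesis by (simp add: inv)
qed

locale sphere_function =
  fixes \<Omega> W :: "real^'n \<Rightarrow> complex"
  assumes W [measurable]: "W \<in> borel_measurable borel"
    and W_hom: "\<And>t x. t > 0 \<Longrightarrow> W (t *\<^sub>R x) = W x"
    and ae: "AE x in sphere_borel. \<Omega> x = W x"
begin

lemma W_sgn: "z \<noteq> 0 \<Longrightarrow> W (sgn z) = W z"
  by (simp add: sgn_div_norm W_hom)

lemma measurable_matrix [measurable]: "(*v) A \<in> borel_measurable borel" for A :: "real^'n^'n"
  by (intro borel_measurable_continuous_onI linear_continuous_on matrix_vector_mul_bounded_linear)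

lemma sgn_orthogonal:
  fixes \<rho> :: "real^'n^'n"
  assumes "orthogonal_matrix \<rho>"
  shows "sgn (\<rho> *v z) = \<rho> *v sgn z" "\<rho> *v z = 0 \<longleftrightarrow> z = 0"
proof -
  have "norm (\<rho> *v z) = norm z"
    using assms orthogonal_transformation_matrix[of "(*v) \<rho>"]
    by (simp add: matrix_vector_mul_linear orthogonal_transformation)
  then show "sgn (\<rho> *v z) = \<rho> *v sgn z" "\<rho> *v z = 0 \<longleftrightarrow> z = 0"
    by (simp_all add: sgn_div_norm matrix_vector_mult_scaleR flip: norm_eq_zero[of "\<rho> *v z"])
qed

lemma AE_rotated:
  assumes \<rho>: "orthogonal_matrix \<rho>"
  shows "AE x in sphere_borel. \<Omega> (\<rho> *v x) = W (\<rho> *v x)"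
proof -
  obtain N where N: "{x \<in> space sphere_borel. \<Omega> x \<noteq> W x} \<subseteq> N" "N \<in> null_sets sphere_borel"
    using ae unfolding eventually_ae_filter by blast
  then have [measurable]: "N \<in> sets borel" by auto
  have "AE z in lborel. sgn z \<notin> N"
    by (rule AE_sphere_borelD) (rule AE_not_in[OF N(2)])
  then have "AE z in lborel. sgn (\<rho> *v z) \<notin> N"
    by (rule AE_lborel_orthogonal[OF \<rho>])
  then have "AE z in lborel. \<rho> *v sgn z \<notin> N" by (simp add: sgn_orthogonal[OF \<rho>])
  then have "AE x in sphere_borel. \<rho> *v x \<notin> N" by (rule AE_sphere_borelI) measurable
  then show ?thesis by eventually_elim (use N(1) in auto)
qed

lemma rotated_diff_power_le:
  assumes \<rho>: "orthogonal_matrix \<rho>" and s: "1 \<le> s"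
    and int: "integrable sphere_measure (\<lambda>x. norm (\<Omega> x) powr s)"
  shows "(\<integral>\<^sup>+z\<in>ball 0 1. ennreal (norm (W z) powr s) \<partial>lborel) < \<infinity>" (is ?th1)
    and "(\<integral>\<^sup>+z\<in>ball 0 1. ennreal (norm (W (\<rho> *v z) - W z) powr s) \<partial>lborel) =
       ennreal (unit_ball_vol (real CARD('n)) * Lp_norm sphere_measure s (\<lambda>x. \<Omega> (\<rho> *v x) - \<Omega> x) powr s)" (is ?th2)
proof -
  have z0: "AE z in lborel. z \<noteq> (0::real^'n)" by (rule AE_lborel_singleton)
  have ball_m [measurable]: "ball (0::real^'n) 1 \<in> sets borel" by simp
  have "AE x in sphere_borel. norm (W x) powr s = norm (\<Omega> x) powr s"
    using ae by eventually_elim simp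
  moreover have "(\<lambda>x. norm (W x) powr s) \<in> borel_measurable sphere_borel" by measurable
  ultimately have "integrable sphere_borel (\<lambda>x. norm (W x) powr s)"
    using int integral_completion_AE(2)[of "\<lambda>x. norm (W x) powr s" sphere_borel "\<lambda>x. norm (\<Omega> x) powr s"]
    by (simp add: sphere_measure_eq)
  then have fin: "(\<integral>\<^sup>+x. ennreal (norm (W x) powr s) \<partial>sphere_borel) < \<infinity>"
    by (simp add: integrable_iff_bounded)
  have "(\<integral>\<^sup>+z\<in>ball 0 1. ennreal (norm (W z) powr s) \<partial>lborel) = (\<integral>\<^sup>+z\<in>ball 0 1. ennreal (norm (W (sgn z)) powr s) \<partial>lborel)"
  proof (intro nn_integral_cong_AE)
    show "AE z in lborel. ennreal (norm (W z) powr s) * indicator (ball 0 1) z =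
       ennreal (norm (W (sgn z)) powr s) * indicator (ball 0 1) z"
      using z0 by eventually_elim (simp add: W_sgn)
  qed
  also have "\<dots> = ennreal (unit_ball_vol (real CARD('n))) * (\<integral>\<^sup>+x. ennreal (norm (W x) powr s) \<partial>sphere_borel)"
    by (subst nn_integral_sphere_borel) auto
  also have "\<dots> < \<infinity>" using fin by (simp add: ennreal_mult_less_top)
  finally show th1: ?th1 .
  have "(\<integral>\<^sup>+z\<in>ball 0 1. ennreal (norm (W (\<rho> *v z) - W z) powr s) \<partial>lborel) \<le>
    (\<integral>\<^sup>+z. ennreal (2 powr s) * (ennreal (norm (W (\<rho> *v z)) powr s) * indicator (ball 0 1) z)
       + ennreal (2 powr s) * (ennreal (norm (W z) powr s) * indicator (ball 0 1) z) \<partial>lborel)"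
  proof (intro nn_integral_mono)
    fix z
    have "norm (W (\<rho> *v z) - W z) powr s \<le> (norm (W (\<rho> *v z)) + norm (W z)) powr s"
      using s by (intro powr_mono2 norm_triangle_ineq4) auto
    also have "\<dots> \<le> 2 powr s * (norm (W (\<rho> *v z)) powr s + norm (W z) powr s)"
      using s by (intro powr_add_le_two_powr) auto
    finally show "ennreal (norm (W (\<rho> *v z) - W z) powr s) * indicator (ball 0 1) z \<le>
       ennreal (2 powr s) * (ennreal (norm (W (\<rho> *v z)) powr s) * indicator (ball 0 1) z)
       + ennreal (2 powr s) * (ennreal (norm (W z) powr s) * indicator (ball 0 1) z)"
      by (auto simp: indicator_def ennreal_mult[symmetric] distrib_left simp flip: ennreal_plus)
  qed
  also have "\<dots> = ennreal (2 powr s) * (\<integral>\<^sup>+z\<in>ball 0 1. ennreal (norm (W (\<rho> *v z)) powr s) \<partial>lborel)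
     + ennreal (2 powr s) * (\<integral>\<^sup>+z\<in>ball 0 1. ennreal (norm (W z) powr s) \<partial>lborel)"
    by (simp add: nn_integral_add nn_integral_cmult)
  also have "\<dots> \<le> ennreal (2 powr s) * (ennreal (lip_const TYPE(real^'n)) * (\<integral>\<^sup>+z\<in>ball 0 1. ennreal (norm (W z) powr s) \<partial>lborel))
     + ennreal (2 powr s) * (\<integral>\<^sup>+z\<in>ball 0 1. ennreal (norm (W z) powr s) \<partial>lborel)"
    by (intro add_right_mono mult_left_mono nn_integral_ball_orthogonal_le[OF \<rho>]) auto
  also have "\<dots> < \<infinity>" using th1 by (simp add: ennreal_mult_less_top)
  finally have fin2: "(\<integral>\<^sup>+z\<in>ball 0 1. ennreal (norm (W (\<rho> *v z) - W z) powr s) \<partial>lborel) < \<infinity>" .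
  have eq: "(\<integral>\<^sup>+z\<in>ball 0 1. ennreal (norm (W (\<rho> *v z) - W z) powr s) \<partial>lborel) =
     ennreal (unit_ball_vol (real CARD('n))) * (\<integral>\<^sup>+x. ennreal (norm (W (\<rho> *v x) - W x) powr s) \<partial>sphere_borel)"
  proof -
    have "(\<integral>\<^sup>+z\<in>ball 0 1. ennreal (norm (W (\<rho> *v z) - W z) powr s) \<partial>lborel)
      = (\<integral>\<^sup>+z\<in>ball 0 1. ennreal (norm (W (\<rho> *v sgn z) - W (sgn z)) powr s) \<partial>lborel)"
    proof (intro nn_integral_cong_AE)
      show "AE z in lborel. ennreal (norm (W (\<rho> *v z) - W z) powr s) * indicator (ball 0 1) z =
         ennreal (norm (W (\<rho> *v sgn z) - W (sgn z)) powr s) * indicator (ball 0 1) z"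
        using z0
      proof eventually_elim
        case (elim z)
        then have "W (\<rho> *v sgn z) = W (\<rho> *v z)" "W (sgn z) = W z"
          using W_sgn[of "\<rho> *v z"] W_sgn[of z] sgn_orthogonal[OF \<rho>, of z] by auto
        then show ?case by simp
      qed
    qed
    also have "\<dots> = ennreal (unit_ball_vol (real CARD('n))) * (\<integral>\<^sup>+x. ennreal (norm (W (\<rho> *v x) - W x) powr s) \<partial>sphere_borel)"
      by (subst nn_integral_sphere_borel) auto
    finally show ?thesis .
  qed
  have vol: "0 < unit_ball_vol (real CARD('n))" by simp
  have int2: "integrable sphere_borel (\<lambda>x. norm (W (\<rho> *v x) - W x) powr s)"
    using fin2 vol unfolding eq by (auto simp: integrable_iff_bounded ennreal_mult_less_top)
  have "AE x in sphere_borel. norm (W (\<rho> *v x) - W x) powr s = norm (\<Omega> (\<rho> *v x) - \<Omega> x) powr s"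
    using ae AE_rotated[OF \<rho>] by eventually_elim simp
  then have "(\<integral>x. norm (\<Omega> (\<rho> *v x) - \<Omega> x) powr s \<partial>sphere_measure) = (\<integral>x. norm (W (\<rho> *v x) - W x) powr s \<partial>sphere_borel)"
    unfolding sphere_measure_eq by (rule integral_completion_AE(1)[rotated]) measurable
  then have "Lp_norm sphere_measure s (\<lambda>x. \<Omega> (\<rho> *v x) - \<Omega> x) powr s = (\<integral>x. norm (W (\<rho> *v x) - W x) powr s \<partial>sphere_borel)"
    using s by (simp add: Lp_norm_def powr_powr)
  then show ?th2
    unfolding eq using nn_integral_eq_integral[OF int2] vol by (simp add: ennreal_mult)
qed

end

section \<open>Reduction to the dual exponent\<close>

lemma dini_modulus_mono: "\<delta> \<le> \<epsilon> \<Longrightarrow> dini_modulus s \<Omega> \<delta> \<le> dini_modulus s \<Omega> \<epsilon>"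
  unfolding dini_modulus_def by (rule SUP_subset_mono) auto

lemma dini_modulus_dyadic_summable:
  assumes "(\<integral>\<^sup>+ \<delta> \<in> {0<..<1}. dini_modulus s \<Omega> \<delta> / ennreal \<delta> \<partial>lborel) < \<infinity>"
  shows "dini_modulus s \<Omega> ((1/2) ^ Suc k) < \<infinity>"
    and "summable (\<lambda>k. enn2real (dini_modulus s \<Omega> ((1/2) ^ Suc k)))"
proof -
  define w where "w k = dini_modulus s \<Omega> ((1/2) ^ Suc k)" for k
  define I :: "nat \<Rightarrow> real set" where "I k = {(1/2) ^ Suc k ..< (1/2) ^ k}" for k
  have [measurable]: "I k \<in> sets borel" for k by (simp add: I_def)
  have disj: "\<delta> \<notin> I k" if "\<delta> \<in> I j" "j < k" for \<delta> j k
  proof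
    assume "\<delta> \<in> I k"
    moreover have "(1/2::real) ^ k \<le> (1/2) ^ Suc j" using that(2) by (intro power_decreasing) auto
    ultimately show False using that(1) by (simp add: I_def)
  qed
  have "(\<Sum>k. w k * ennreal (1/2)) = (\<Sum>k. \<integral>\<^sup>+\<delta>. w k * ennreal (2 ^ k) * indicator (I k) \<delta> \<partial>lborel)"
  proof (intro suminf_cong)
    fix k
    have "(\<integral>\<^sup>+\<delta>. w k * ennreal (2 ^ k) * indicator (I k) \<delta> \<partial>lborel) = w k * ennreal (2 ^ k) * emeasure lborel (I k)"
      by (simp add: nn_integral_cmult)
    also have "emeasure lborel (I k) = ennreal ((1/2) ^ k - (1/2) ^ Suc k)"
      unfolding I_def by (rule emeasure_lborel_Ico) simp
    also have "w k * ennreal (2 ^ k) * \<dots> = w k * ennreal (2 ^ k * ((1/2) ^ k - (1/2) ^ Suc k))"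
      by (subst mult.assoc, subst ennreal_mult[symmetric]) simp_all
    also have "2 ^ k * ((1/2) ^ k - (1/2) ^ Suc k) = (1/2::real)"
      by (simp add: power_one_over field_simps)
    finally show "w k * ennreal (1/2) = (\<integral>\<^sup>+\<delta>. w k * ennreal (2 ^ k) * indicator (I k) \<delta> \<partial>lborel)" by simp
  qed
  also have "\<dots> = (\<integral>\<^sup>+\<delta>. (\<Sum>k. w k * ennreal (2 ^ k) * indicator (I k) \<delta>) \<partial>lborel)"
    by (rule nn_integral_suminf[symmetric]) measurable
  also have "\<dots> \<le> (\<integral>\<^sup>+ \<delta> \<in> {0<..<1}. dini_modulus s \<Omega> \<delta> / ennreal \<delta> \<partial>lborel)"
  proof (intro nn_integral_mono)
    fix \<delta> :: real
    show "(\<Sum>k. w k * ennreal (2 ^ k) * indicator (I k) \<delta>) \<le> dini_modulus s \<Omega> \<delta> / ennreal \<delta> * indicator {0<..<1} \<delta>"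
    proof (cases "\<exists>j. \<delta> \<in> I j")
      case True
      then obtain j where j: "\<delta> \<in> I j" by blast
      have "\<delta> \<notin> I k" if "k \<noteq> j" for k using disj[of \<delta> j k] disj[of \<delta> k j] j that by (cases k j rule: linorder_cases) auto
      then have "(\<Sum>k. w k * ennreal (2 ^ k) * indicator (I k) \<delta>) = (\<Sum>k\<in>{j}. w k * ennreal (2 ^ k) * indicator (I k) \<delta>)"
        by (intro suminf_finite) auto
      also have "\<dots> = w j * ennreal (2 ^ j)" using j by simp
      also have "\<dots> \<le> dini_modulus s \<Omega> \<delta> * ennreal (inverse \<delta>)"
      proof (intro mult_mono ennreal_leI)
        show "w j \<le> dini_modulus s \<Omega> \<delta>" unfolding w_def using j by (intro dini_modulus_mono) (simp add: I_def)
        have "0 < (1/2::real) ^ Suc j" by simp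
        then have "0 < \<delta>" "\<delta> \<le> (1/2) ^ j" using j unfolding I_def atLeastLessThan_iff by linarith+
        then have "inverse ((1/2) ^ j) \<le> inverse \<delta>" by (intro le_imp_inverse_le)
        then show "2 ^ j \<le> inverse \<delta>" by (simp add: power_one_over)
      qed auto
      also have "\<dots> = dini_modulus s \<Omega> \<delta> / ennreal \<delta> * indicator {0<..<1} \<delta>"
      proof -
        have "0 < (1/2::real) ^ Suc j" "(1/2::real) ^ j \<le> 1" by (simp_all add: power_le_one)
        then have "0 < \<delta>" "\<delta> < 1" using j unfolding I_def atLeastLessThan_iff by linarith+
        then show ?thesis by (simp add: divide_ennreal_def inverse_ennreal)
      qed
      finally show ?thesis .
    qed simp
  qed
  also have "\<dots> < \<infinity>" by fact
  finally have fin: "(\<Sum>k. w k) * ennreal (1/2) < \<infinity>" by (simp only: ennreal_suminf_multc)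
  have "(\<Sum>k. w k) < \<infinity>"
  proof (rule ccontr)
    assume "\<not> (\<Sum>k. w k) < \<infinity>"
    then have "(\<Sum>k. w k) = \<infinity>" by (simp add: not_less top_unique)
    then show False using fin by (simp add: ennreal_top_mult)
  qed
  moreover have wk: "w k < \<infinity>" for k
    using ennreal_le_suminf[of w k] \<open>(\<Sum>k. w k) < \<infinity>\<close> by (rule le_less_trans)
  then show "dini_modulus s \<Omega> ((1/2) ^ Suc k) < \<infinity>" by (simp add: w_def)
  have "ennreal (enn2real (w k)) = w k" for k using wk[of k] by simp
  then have "(\<Sum>k. ennreal (enn2real (w k))) \<noteq> top" using \<open>(\<Sum>k. w k) < \<infinity>\<close> by simp
  then have "summable (\<lambda>k. enn2real (w k))" by (intro summable_suminf_not_top) auto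
  then show "summable (\<lambda>k. enn2real (dini_modulus s \<Omega> ((1/2) ^ Suc k)))" by (simp add: w_def)
qed

lemma powr_le_exponent_scaled:
  fixes t a q s :: real
  assumes "0 \<le> t" "0 < a" "0 < q" "q \<le> s"
  shows "t powr q \<le> a powr q * ((t / a) powr s + 1)"
proof -
  have "(t / a) powr q \<le> (t / a) powr s + 1"
  proof (cases "t / a \<le> 1")
    case True
    then have "(t / a) powr q \<le> 1" using assms by (intro powr_le1) auto
    then show ?thesis by (intro add_increasing) auto
  next
    case False
    then have "(t / a) powr q \<le> (t / a) powr s" using assms by (intro powr_mono) auto
    then show ?thesis by simp
  qed
  then have "a powr q * (t / a) powr q \<le> a powr q * ((t / a) powr s + 1)"
    by (intro mult_left_mono) auto
  moreover have "a powr q * (t / a) powr q = t powr q" using assms by (simp add: powr_divide)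
  ultimately show ?thesis by simp
qed

lemma nn_integral_ball_exponent_le:
  fixes h :: "'a::euclidean_space \<Rightarrow> real"
  assumes [measurable]: "h \<in> borel_measurable borel" and h: "\<And>x. 0 \<le> h x"
    and a: "0 < a" "0 < q" "q \<le> s"
    and le: "(\<integral>\<^sup>+z\<in>ball 0 1. ennreal (h z powr s) \<partial>lborel) \<le> ennreal (unit_ball_vol (real DIM('a)) * a powr s)"
  shows "(\<integral>\<^sup>+z\<in>ball 0 1. ennreal (h z powr q) \<partial>lborel) \<le> ennreal (2 * unit_ball_vol (real DIM('a)) * a powr q)"
proof -
  have [measurable]: "ball (0::'a) 1 \<in> sets borel" by simp
  let ?v = "unit_ball_vol (real DIM('a))"
  have "(\<integral>\<^sup>+z\<in>ball 0 1. ennreal (h z powr q) \<partial>lborel) \<le>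
    (\<integral>\<^sup>+z. ennreal (a powr q / a powr s) * (ennreal (h z powr s) * indicator (ball 0 1) z)
      + ennreal (a powr q) * indicator (ball 0 1) z \<partial>lborel)"
  proof (intro nn_integral_mono)
    fix z
    have "h z powr q \<le> a powr q * ((h z / a) powr s + 1)" using a h by (intro powr_le_exponent_scaled) auto
    also have "\<dots> = a powr q / a powr s * h z powr s + a powr q"
      using a h[of z] by (simp add: powr_divide algebra_simps)
    finally show "ennreal (h z powr q) * indicator (ball 0 1) z \<le>
      ennreal (a powr q / a powr s) * (ennreal (h z powr s) * indicator (ball 0 1) z)
      + ennreal (a powr q) * indicator (ball 0 1) z"
      using a by (auto simp: indicator_def ennreal_mult[symmetric] simp flip: ennreal_plus)
  qed
  also have "\<dots> = ennreal (a powr q / a powr s) * (\<integral>\<^sup>+z\<in>ball 0 1. ennreal (h z powr s) \<partial>lborel) + ennreal (a powr q) * ennreal ?v"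
    by (simp add: nn_integral_add nn_integral_cmult emeasure_unit_ball)
  also have "\<dots> \<le> ennreal (a powr q / a powr s) * ennreal (?v * a powr s) + ennreal (a powr q) * ennreal ?v"
    by (intro add_right_mono mult_left_mono le) simp
  also have "\<dots> = ennreal (2 * ?v * a powr q)"
    using a by (simp add: ennreal_mult[symmetric] flip: ennreal_plus)
  finally show ?thesis .
qed

lemma sphere_function_exists:
  fixes \<Omega> :: "real^'n \<Rightarrow> complex"
  assumes meas: "\<Omega> \<in> borel_measurable sphere_measure" and hom: "homogeneous_degree_zero \<Omega>"
  obtains W where "sphere_function \<Omega> W" "AE z in lborel. \<Omega> z = W z"
proof -
  obtain g where g: "g \<in> borel_measurable sphere_borel" "AE x in sphere_borel. \<Omega> x = g x"
    using completion_ex_borel_measurable_complex[of \<Omega> sphere_borel] meas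
    unfolding sphere_measure_eq by blast
  then have [measurable]: "g \<in> borel_measurable borel" by simp
  define W where "W z = g (sgn z)" for z :: "real^'n"
  have W [measurable]: "W \<in> borel_measurable borel" unfolding W_def[abs_def] by measurable
  have "AE z in lborel. g (sgn (sgn z)) = g (sgn (z::real^'n))"
  proof (intro AE_I2 arg_cong[of _ _ g])
    show "sgn (sgn z) = sgn z" for z :: "real^'n"
      by (cases "z = 0") (simp_all add: sgn_div_norm)
  qed
  then have "AE x in sphere_borel. g (sgn x) = g x" by (rule AE_sphere_borelI) measurable
  then have ae: "AE x in sphere_borel. \<Omega> x = W x"
    using g(2) by eventually_elim (simp add: W_def)
  have "sphere_function \<Omega> W"
    by standard (simp_all add: ae W, simp add: W_def sgn_scaleR)
  moreover have "AE z in lborel. \<Omega> z = W z"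
    using AE_sphere_borelD[OF g(2)] AE_lborel_singleton[of 0]
  proof eventually_elim
    case (elim z)
    then have "\<Omega> (sgn z) = \<Omega> z"
      using hom by (simp add: homogeneous_degree_zero_def sgn_div_norm)
    then show ?case using elim by (simp add: W_def)
  qed
  ultimately show ?thesis by (rule that)
qed

lemma dini_condition_imp_kernel:
  fixes \<Omega> :: "real^'n \<Rightarrow> complex"
  assumes dim: "2 \<le> CARD('n)" and \<alpha>: "0 < \<alpha>" "\<alpha> < real CARD('n)"
    and q: "q = real CARD('n) / (real CARD('n) - \<alpha>)" and qs: "ennreal q \<le> s"
    and dini: "dini_condition s \<Omega>"
  obtains W M d where "dini_kernel W \<alpha> q M d" "AE z in lborel. \<Omega> z = W z"
proof -
  have dini': "1 \<le> s" "in_Lp sphere_measure s \<Omega>" "homogeneous_degree_zero \<Omega>"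
    "(\<integral>\<^sup>+ \<delta> \<in> {0<..<1}. dini_modulus s \<Omega> \<delta> / ennreal \<delta> \<partial>lborel) < \<infinity>"
    using dini by (auto simp: dini_condition_def)
  have q1: "1 < q" using \<alpha> by (simp add: q field_simps)
  have "\<Omega> \<in> borel_measurable sphere_measure" using dini'(2) by (simp add: in_Lp_def)
  then obtain W where sf: "sphere_function \<Omega> W" and aeL: "AE z in lborel. \<Omega> z = W z"
    using sphere_function_exists dini'(3) by blast
  interpret sphere_function \<Omega> W by (rule sf)
  have [measurable]: "ball (0::real^'n) 1 \<in> sets borel" by simp
  define v where "v = unit_ball_vol (real CARD('n))"
  have v: "v > 0" by (simp add: v_def)
  define a where "a k = enn2real (dini_modulus s \<Omega> ((1/2) ^ Suc k)) + (1/2) ^ k" for k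
  define d where "d k = (1 + 2 * v) * a k" for k
  have a0: "a k > 0" for k by (simp add: a_def add_nonneg_pos)
  have term_le: "(if s = \<infinity> then SUP x \<in> sphere 0 1. ennreal (norm (\<Omega> (\<rho> *v x) - \<Omega> x))
        else ennreal (Lp_norm sphere_measure (enn2real s) (\<lambda>x. \<Omega> (\<rho> *v x) - \<Omega> x))) \<le> ennreal (a k)"
    if "rotation_matrix \<rho>" "rot_size \<rho> < (1/2) ^ Suc k" for \<rho> k
  proof -
    have "(if s = \<infinity> then SUP x \<in> sphere 0 1. ennreal (norm (\<Omega> (\<rho> *v x) - \<Omega> x))
        else ennreal (Lp_norm sphere_measure (enn2real s) (\<lambda>x. \<Omega> (\<rho> *v x) - \<Omega> x))) \<le> dini_modulus s \<Omega> ((1/2) ^ Suc k)"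
      unfolding dini_modulus_def by (rule SUP_upper) (use that in simp)
    also have "\<dots> = ennreal (enn2real (dini_modulus s \<Omega> ((1/2) ^ Suc k)))"
      using dini_modulus_dyadic_summable(1)[OF dini'(4), of k] by simp
    also have "\<dots> \<le> ennreal (a k)" unfolding a_def by (intro ennreal_leI) simp
    finally show ?thesis .
  qed
  have dq: "2 * v * a k powr q \<le> d k powr q" for k
  proof -
    have "2 * v \<le> (1 + 2 * v) powr 1" using v by simp
    also have "\<dots> \<le> (1 + 2 * v) powr q" using q1 v by (intro powr_mono) auto
    finally have "2 * v * a k powr q \<le> (1 + 2 * v) powr q * a k powr q" by (intro mult_right_mono) auto
    then show ?thesis using v a0[of k] by (simp add: d_def powr_mult)
  qed
  have key: "(\<integral>\<^sup>+u\<in>ball 0 1. ennreal (norm (W u) powr q) \<partial>lborel) < \<infinity> \<and>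
     (\<forall>k \<rho>. rotation_matrix \<rho> \<longrightarrow> rot_size \<rho> < (1/2) ^ Suc k \<longrightarrow>
      (\<integral>\<^sup>+u\<in>ball 0 1. ennreal (norm (W (\<rho> *v u) - W u) powr q) \<partial>lborel) \<le> ennreal (2 * v * a k powr q))"
  proof (cases "s = \<infinity>")
    case True
    obtain c where c: "AE x in sphere_measure. norm (\<Omega> x) \<le> c"
      using dini'(2) True by (auto simp: in_Lp_def)
    then have "AE x in sphere_borel. norm (\<Omega> x) \<le> c"
      unfolding sphere_measure_eq by (simp add: AE_completion_iff)
    then have "AE x in sphere_borel. norm (W x) \<le> c" using sphere_function.ae[OF sf]
      by eventually_elim simp
    then have "AE z in lborel. norm (W (sgn z)) \<le> c" by (rule AE_sphere_borelD)
    then have Wc: "AE z in lborel. norm (W z) \<le> c"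
      using AE_lborel_singleton[of 0] by eventually_elim (simp add: W_sgn)
    have "(\<integral>\<^sup>+u\<in>ball 0 1. ennreal (norm (W u) powr q) \<partial>lborel) \<le> (\<integral>\<^sup>+u\<in>ball (0::real^'n) 1. ennreal (c powr q) \<partial>lborel)"
    proof (intro nn_integral_mono_AE)
      show "AE u in lborel. ennreal (norm (W u) powr q) * indicator (ball 0 1) u \<le> ennreal (c powr q) * indicator (ball 0 1) u"
        using Wc by eventually_elim (use q1 in \<open>auto intro!: mult_right_mono ennreal_leI powr_mono2\<close>)
    qed
    also have "\<dots> < \<infinity>" by (simp add: nn_integral_cmult emeasure_unit_ball ennreal_mult_less_top)
    finally have 1: "(\<integral>\<^sup>+u\<in>ball 0 1. ennreal (norm (W u) powr q) \<partial>lborel) < \<infinity>" .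
    have 2: "(\<integral>\<^sup>+u\<in>ball 0 1. ennreal (norm (W (\<rho> *v u) - W u) powr q) \<partial>lborel) \<le> ennreal (2 * v * a k powr q)"
      if \<rho>: "rotation_matrix \<rho>" "rot_size \<rho> < (1/2) ^ Suc k" for \<rho> k
    proof -
      have orth: "orthogonal_matrix \<rho>" using \<rho>(1) by (simp add: rotation_matrix_def)
      have le: "norm (\<Omega> (\<rho> *v x) - \<Omega> x) \<le> a k" if "norm x = 1" for x
      proof -
        have "ennreal (norm (\<Omega> (\<rho> *v x) - \<Omega> x)) \<le> (SUP x \<in> sphere 0 1. ennreal (norm (\<Omega> (\<rho> *v x) - \<Omega> x)))"
          by (rule SUP_upper) (use that in simp)
        also have "\<dots> \<le> ennreal (a k)" using term_le[OF \<rho>] True by simp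
        finally show ?thesis using a0[of k] by (simp add: ennreal_le_iff)
      qed
      have hom: "\<Omega> (sgn z) = \<Omega> z" if "z \<noteq> 0" for z
        using that dini'(3) by (simp add: homogeneous_degree_zero_def sgn_div_norm)
      have "AE u in lborel. norm (W (\<rho> *v u) - W u) \<le> a k"
        using aeL AE_lborel_orthogonal[OF orth aeL] AE_lborel_singleton[of 0]
      proof eventually_elim
        case (elim u)
        have "W (\<rho> *v u) = \<Omega> (sgn (\<rho> *v u))" using elim hom sgn_orthogonal(2)[OF orth, of u] by metis
        also have "\<dots> = \<Omega> (\<rho> *v sgn u)" by (simp add: sgn_orthogonal[OF orth])
        finally have "W (\<rho> *v u) = \<Omega> (\<rho> *v sgn u)" .
        moreover have "W u = \<Omega> (sgn u)" using elim hom by metis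
        ultimately show ?case using le[of "sgn u"] elim(3) by (simp add: norm_sgn)
      qed
      then have "(\<integral>\<^sup>+u\<in>ball 0 1. ennreal (norm (W (\<rho> *v u) - W u) powr q) \<partial>lborel) \<le> (\<integral>\<^sup>+u\<in>ball (0::real^'n) 1. ennreal (a k powr q) \<partial>lborel)"
      proof (intro nn_integral_mono_AE)
        assume "AE u in lborel. norm (W (\<rho> *v u) - W u) \<le> a k"
        then show "AE u in lborel. ennreal (norm (W (\<rho> *v u) - W u) powr q) * indicator (ball 0 1) u \<le> ennreal (a k powr q) * indicator (ball 0 1) u"
          by eventually_elim (use q1 in \<open>auto intro!: mult_right_mono ennreal_leI powr_mono2\<close>)
      qed
      also have "\<dots> = ennreal (v * a k powr q)"
        using v by (simp add: nn_integral_cmult emeasure_unit_ball v_def ennreal_mult[symmetric] mult.commute)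
      also have "\<dots> \<le> ennreal (2 * v * a k powr q)" using v by (intro ennreal_leI mult_right_mono) auto
      finally show ?thesis .
    qed
    show ?thesis using 1 2 by blast
  next
    case False
    define t where "t = enn2real s"
    have t: "s = ennreal t" using False by (simp add: t_def less_top)
    have qt: "q \<le> t" using qs q1 unfolding t by (simp add: ennreal_le_iff2)
    have int: "integrable sphere_measure (\<lambda>x. norm (\<Omega> x) powr t)"
      using dini'(2) False by (simp add: in_Lp_def t_def)
    have id: "orthogonal_matrix (mat 1 :: real^'n^'n)" by (simp add: orthogonal_matrix_id)
    have "(\<integral>\<^sup>+z\<in>ball 0 1. ennreal (norm (W z) powr t) \<partial>lborel) < \<infinity>"
      using q1 qt by (intro rotated_diff_power_le(1)[OF id _ int]) auto
    then obtain b where b: "(\<integral>\<^sup>+z\<in>ball 0 1. ennreal (norm (W z) powr t) \<partial>lborel) = ennreal b" "0 \<le> b"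
      by (cases "\<integral>\<^sup>+z\<in>ball 0 1. ennreal (norm (W z) powr t) \<partial>lborel") auto
    define c where "c = (b / v + 1) powr (1 / t)"
    have c: "c > 0" "b \<le> v * c powr t"
      using b(2) v q1 qt by (auto simp: c_def powr_powr field_simps add_pos_nonneg)
    have "(\<integral>\<^sup>+u\<in>ball 0 1. ennreal (norm (W u) powr q) \<partial>lborel) \<le> ennreal (2 * unit_ball_vol (real DIM(real^'n)) * c powr q)"
      using q1 qt c b by (intro nn_integral_ball_exponent_le[where s=t]) (auto simp: v_def ennreal_leI)
    also have "\<dots> < \<infinity>" by simp
    finally have 1: "(\<integral>\<^sup>+u\<in>ball 0 1. ennreal (norm (W u) powr q) \<partial>lborel) < \<infinity>" .
    have 2: "(\<integral>\<^sup>+u\<in>ball 0 1. ennreal (norm (W (\<rho> *v u) - W u) powr q) \<partial>lborel) \<le> ennreal (2 * v * a k powr q)"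
      if \<rho>: "rotation_matrix \<rho>" "rot_size \<rho> < (1/2) ^ Suc k" for \<rho> k
    proof -
      have orth: "orthogonal_matrix \<rho>" using \<rho>(1) by (simp add: rotation_matrix_def)
      let ?L = "Lp_norm sphere_measure t (\<lambda>x. \<Omega> (\<rho> *v x) - \<Omega> x)"
      have L: "?L \<le> a k" "0 \<le> ?L"
        using term_le[OF \<rho>] False a0[of k] by (simp_all add: t_def ennreal_le_iff Lp_norm_def)
      have "(\<integral>\<^sup>+z\<in>ball 0 1. ennreal (norm (W (\<rho> *v z) - W z) powr t) \<partial>lborel) = ennreal (v * ?L powr t)"
        unfolding v_def using q1 qt by (intro rotated_diff_power_le(2)[OF orth _ int]) auto
      also have "\<dots> \<le> ennreal (v * a k powr t)"
        using v L q1 qt by (intro ennreal_leI mult_left_mono powr_mono2) auto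
      finally have "(\<integral>\<^sup>+u\<in>ball 0 1. ennreal (norm (W (\<rho> *v u) - W u) powr q) \<partial>lborel)
         \<le> ennreal (2 * unit_ball_vol (real DIM(real^'n)) * a k powr q)"
        using q1 qt a0[of k] by (intro nn_integral_ball_exponent_le[where s=t]) (auto simp: v_def)
      then show ?thesis by (simp add: v_def)
    qed
    show ?thesis using 1 2 by blast
  qed
  then obtain M where M: "(\<integral>\<^sup>+u\<in>ball 0 1. ennreal (norm (W u) powr q) \<partial>lborel) = ennreal M" "0 \<le> M"
    by (cases "\<integral>\<^sup>+u\<in>ball 0 1. ennreal (norm (W u) powr q) \<partial>lborel") auto
  have "dini_kernel W \<alpha> q M d"
  proof
    fix k
    have "1 * (1/2) ^ k \<le> (1 + 2 * v) * a k"
      using v by (intro mult_mono) (auto simp: a_def)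
    then show "(1/2) ^ k \<le> d k" by (simp add: d_def)
    fix \<rho> :: "real^'n^'n" assume "rotation_matrix \<rho>" "rot_size \<rho> < (1/2) ^ Suc k"
    then have "(\<integral>\<^sup>+u\<in>ball 0 1. ennreal (norm (W (\<rho> *v u) - W u) powr q) \<partial>lborel) \<le> ennreal (2 * v * a k powr q)"
      using key by blast
    also have "\<dots> \<le> ennreal (d k powr q)" by (intro ennreal_leI dq)
    finally show "(\<integral>\<^sup>+u\<in>ball 0 1. ennreal (norm (W (\<rho> *v u) - W u) powr q) \<partial>lborel) \<le> ennreal (d k powr q)" .
  next
    show "summable d"
      unfolding d_def a_def
      by (intro summable_mult summable_add dini_modulus_dyadic_summable(2)[OF dini'(4)]) (simp add: summable_geometric)
  qed (use dim \<alpha> q W_hom M in auto)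
  then show ?thesis using aeL by (rule that)
qed

lemma frac_int_op_eq_T:
  assumes "dini_kernel W \<alpha> q M d" and ae: "AE z in lborel. \<Omega> z = W z"
    and g: "g \<in> borel_measurable borel" "AE z in lborel. f z = g z"
  shows "frac_int_op \<Omega> \<alpha> f = dini_kernel.T W \<alpha> g"
proof
  fix x
  interpret dini_kernel W \<alpha> q M d by fact
  note [measurable] = g(1)
  have "AE y in lborel. \<Omega> (x - y) = W (x - y)"
    using AE_lborel_affine[OF _ ae, of "-1" x] by simp
  then have "AE y in lborel. K (x - y) * g y = \<Omega> (x - y) / of_real (norm (x - y) powr (real CARD('a) - \<alpha>)) * f y"
    using g(2) by eventually_elim (simp add: K_def)
  moreover have "(\<lambda>y. K (x - y) * g y) \<in> borel_measurable lborel" by measurable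
  ultimately show "frac_int_op \<Omega> \<alpha> f x = T g x"
    unfolding frac_int_op_def T_def by (intro integral_completion_AE(1))
qed

theorem theorem2p7:
  fixes \<Omega> :: "real^'n \<Rightarrow> complex" and \<alpha> p :: real and s :: ennreal
  assumes "CARD('n) \<ge> 2"
    and "0 < \<alpha>" "\<alpha> < real CARD('n)"
    and "p = real CARD('n) / \<alpha>"
    and "ennreal (real CARD('n) / (real CARD('n) - \<alpha>)) \<le> s"
    and "dini_condition s \<Omega>"
  shows "\<exists>C>0. \<forall>f :: real^'n \<Rightarrow> complex. in_Lp lebesgue (ennreal p) f \<longrightarrow>
           bmo_norm (frac_int_op \<Omega> \<alpha> f) \<le> ennreal (C * Lp_norm lebesgue p f)"
proof -
  define q where "q = real CARD('n) / (real CARD('n) - \<alpha>)"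
  obtain W M d where kernel: "dini_kernel W \<alpha> q M d" and ae: "AE z in lborel. \<Omega> z = W z"
    using dini_condition_imp_kernel[OF assms(1-3) q_def _ assms(6)] assms(5) unfolding q_def by blast
  interpret dini_kernel W \<alpha> q M d by fact
  define v where "v = unit_ball_vol (real CARD('n))"
  have v: "v > 0" by (simp add: v_def)
  define C where "C = C_osc / v\<^sup>2 + 1"
  have C: "C > 0" using C_osc_nonneg by (simp add: C_def add_nonneg_pos)
  have p: "p > 1" using conjugate_exponents(1)[OF assms(4)] .
  have "bmo_norm (frac_int_op \<Omega> \<alpha> f) \<le> ennreal (C * Lp_norm lebesgue p f)"
    if f: "in_Lp lebesgue (ennreal p) f" for f :: "real^'n \<Rightarrow> complex"
  proof -
    define L where "L = Lp_norm lebesgue p f"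
    have L0: "0 \<le> L" by (simp add: L_def Lp_norm_def)
    have f': "f \<in> borel_measurable lebesgue" "integrable lebesgue (\<lambda>x. norm (f x) powr p)"
      using f p by (auto simp: in_Lp_def)
    obtain g where g: "g \<in> borel_measurable lborel" "AE x in lborel. f x = g x"
      using completion_ex_borel_measurable_complex[OF f'(1)] by blast
    then have [measurable]: "g \<in> borel_measurable borel" by simp
    have "AE x in lborel. norm (g x) powr p = norm (f x) powr p"
      using g(2) by eventually_elim simp
    moreover have "(\<lambda>x. norm (g x) powr p) \<in> borel_measurable lborel" by measurable
    ultimately have "integrable lborel (\<lambda>x. norm (g x) powr p)"
      and "(\<integral>x. norm (f x) powr p \<partial>lebesgue) = (\<integral>x. norm (g x) powr p \<partial>lborel)"
      using integral_completion_AE[of "\<lambda>x. norm (g x) powr p" lborel "\<lambda>x. norm (f x) powr p"] f'(2)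
      by simp_all
    then have gL: "(\<integral>\<^sup>+x. ennreal (norm (g x) powr p) \<partial>lborel) = ennreal (L powr p)"
      using p by (simp add: L_def Lp_norm_def powr_powr nn_integral_eq_integral)
    have T: "frac_int_op \<Omega> \<alpha> f = T g"
      by (rule frac_int_op_eq_T[OF kernel ae _ g(2)]) simp
    have osc: "set_integrable lebesgue (ball a r) (T g)"
        "mean_on (ball a r) (\<lambda>x. norm (T g x - mean_on (ball a r) (T g))) \<le> C_osc / v\<^sup>2 * (L + \<epsilon>)"
      if r: "0 < r" and \<epsilon>: "0 < \<epsilon>" for a r \<epsilon>
    proof -
      have A: "0 < L + \<epsilon>" using L0 \<epsilon> by simp
      have "(\<integral>\<^sup>+x. ennreal (norm (g x) powr p) \<partial>lborel) \<le> ennreal ((L + \<epsilon>) powr p)"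
        unfolding gL using L0 \<epsilon> p by (intro ennreal_leI powr_mono2) auto
      then have "(\<integral>\<^sup>+x\<in>ball a r. (\<integral>\<^sup>+x'\<in>ball a r. ennreal (norm (T g x - T g x')) \<partial>lborel) \<partial>lborel)
        \<le> ennreal (C_osc * (L + \<epsilon>) * (r ^ CARD('n))\<^sup>2)"
        by (intro T_oscillation_le[OF _ assms(4) A _ r]) auto
      note * = mean_oscillation_le[OF T_measurable r _ this]
      have nonneg: "0 \<le> C_osc * (L + \<epsilon>) * (r ^ CARD('n))\<^sup>2" using C_osc_nonneg A by simp
      show "set_integrable lebesgue (ball a r) (T g)" using *(1)[OF _ nonneg] by simp
      have "measure lebesgue (ball a r) = v * r ^ CARD('n)"
        using r by (simp add: content_ball v_def)
      then have "C_osc * (L + \<epsilon>) * (r ^ CARD('n))\<^sup>2 / (measure lebesgue (ball a r))\<^sup>2 = C_osc / v\<^sup>2 * (L + \<epsilon>)"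
        using r v by (simp add: power_mult_distrib)
      then show "mean_on (ball a r) (\<lambda>x. norm (T g x - mean_on (ball a r) (T g))) \<le> C_osc / v\<^sup>2 * (L + \<epsilon>)"
        using *(2)[OF _ nonneg] by simp
    qed
    have mean_le: "mean_on (ball a r) (\<lambda>x. norm (T g x - mean_on (ball a r) (T g))) \<le> C * L"
      if r: "0 < r" for a r
    proof (rule field_le_epsilon)
      fix e :: real assume e: "0 < e"
      have "mean_on (ball a r) (\<lambda>x. norm (T g x - mean_on (ball a r) (T g))) \<le> C_osc / v\<^sup>2 * (L + e / C)"
        using e C by (intro osc(2) r) simp
      also have "\<dots> \<le> C * (L + e / C)"
        using L0 e C by (intro mult_right_mono) (auto simp: C_def)
      also have "\<dots> = C * L + e" using C by (simp add: distrib_left)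
      finally show "mean_on (ball a r) (\<lambda>x. norm (T g x - mean_on (ball a r) (T g))) \<le> C * L + e" .
    qed
    have "\<forall>a r. 0 < r \<longrightarrow> set_integrable lebesgue (ball a r) (T g)"
      using osc(1)[OF _ zero_less_one] by blast
    then show ?thesis
      unfolding T bmo_norm_def L_def[symmetric] by (auto intro!: SUP_least ennreal_leI mean_le)
  qed
  then show ?thesis using C by blast
qed

end
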